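(* Let $A$ be a C$^*$-algebra of real rank zero such that $\mathcal{P}(A)$ has no atoms and no $(\omega,\omega)$-gaps. If $(\mathcal{P},\mathcal{Q})$ is a gap in $\mathcal{P}(A)$ for (non-empty) countable $\mathcal{P},\mathcal{Q}\subseteq\mathcal{P}(A)$ then there exists $Q\in\mathcal{P}\cup\mathcal{Q}$ that is both a least upper bound of $\mathcal{P}$ and a greatest lower bound of $\mathcal{Q}$ in $\mathcal{P}(A)$.
   Context: C$^*$-algebras are over the scalar field $\mathbb{F}=\mathbb{R}$ or $\mathbb{C}$. $\mathcal{P}(A)$ is the set of projections (self-adjoint idempotents) of $A$, ordered by $P\leq Q\Leftrightarrow PQ=P$. $A$ has real rank zero if the invertible self-adjoint elements are dense in the self-adjoint elements of $A$ (of $A$ with a unit adjoined, if $A$ has none). In a partial order $\mathbb{P}$ with minimum $0$: an atom is a minimal element of $\mathbb{P}\setminus\{0\}$. For $\mathcal{P},\mathcal{Q}\subseteq\mathbb{P}$, $(\mathcal{P},\mathcal{Q})$ is a pregap if $p<q$ for all $p\in\mathcal{P}$ and $q\in\mathcal{Q}$; $r\in\mathbb{P}$ interpolates it if $p<r<q$ for all $p\in\mathcal{P}$, $q\in\mathcal{Q}$; a gap is a pregap with no interpolating element. An $(\omega,\omega)$-gap is a gap of the form $(\{p_n:n\in\omega\},\{q_n:n\in\omega\})$ with $(p_n)$ strictly increasing and $(q_n)$ strictly decreasing. *)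

theory Defs
  imports "HOL-Analysis.Analysis" "HOL-Algebra.Order"
begin

text \<open>
  The scalar field is the field of real numbers with the identity as conjugation, or the field of
  complex numbers with complex conjugation.  The class has no other members up to isometric
  isomorphism: a commutative field over the reals with a multiplicative norm is one of the two,
  and the axioms then determine the conjugation.
\<close>

class scalar_field = real_normed_field +
  fixes scnj :: "'a \<Rightarrow> 'a"
  assumes scnj_add: "scnj (x + y) = scnj x + scnj y"
    and scnj_mult_self: "scnj x * x = ((norm x)\<^sup>2) *\<^sub>R 1"

instantiation real :: scalar_field
begin
definition scnj_real_def: "scnj (x :: real) = x"
instance by standard (simp_all add: scnj_real_def power2_eq_square)
end

instantiation complex :: scalar_field
begin
definition scnj_complex_def: "scnj (x :: complex) = cnj x"
instance
  by standard (simp_all add: scnj_complex_def scaleR_conv_of_real mult.commute complex_norm_square [symmetric] del: of_real_power)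
end

text \<open>
  The whole type \<open>'a\<close> is the algebra, which need not have a unit; \<open>'f\<close> is the scalar field.  Over
  the complex numbers the axioms are those of a Banach \<open>*\<close>-algebra with the C*-identity.  Over the
  real numbers the C*-identity alone is too weak (it holds for the complex numbers with the trivial
  involution), and the usual additional axiom, which holds for the norm-closed \<open>*\<close>-algebras of
  operators on a real Hilbert space and characterises them, is imposed.
\<close>

locale cstar_algebra = vector_space smul
  for smul :: "'f::scalar_field \<Rightarrow> 'a::{real_normed_algebra, banach} \<Rightarrow> 'a" +
  fixes star :: "'a \<Rightarrow> 'a"
  assumes scale_of_real: "smul (of_real r) x = r *\<^sub>R x"
    and scale_mult_left: "smul c x * y = smul c (x * y)"
    and scale_mult_right: "x * smul c y = smul c (x * y)"
    and norm_scale: "norm (smul c x) = norm c * norm x"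
    and star_star: "star (star x) = x"
    and star_add: "star (x + y) = star x + star y"
    and star_scale: "star (smul c x) = smul (scnj c) (star x)"
    and star_mult: "star (x * y) = star y * star x"
    and cstar_identity: "norm (star x * x) = (norm x)\<^sup>2"
    and real_cstar:
      "(\<forall>c::'f. scnj c = c) \<Longrightarrow> (norm x)\<^sup>2 \<le> norm (star x * x + star y * y)"

definition unit_element :: "'a::times \<Rightarrow> bool" where
  "unit_element e \<longleftrightarrow> (\<forall>x. e * x = x \<and> x * e = x)"

text \<open>
  A pair \<open>(a, c)\<close> stands for the element \<open>a + c1\<close> of the algebra with a unit adjoined.  The norm is
  the operator norm of left multiplication on the algebra, which is the C*-norm if the algebra has
  no unit; the definitions are used only in that case.
\<close>

definition uzn_mult ::
  "('f::times \<Rightarrow> 'a::{plus, times} \<Rightarrow> 'a) \<Rightarrow> 'a \<times> 'f \<Rightarrow> 'a \<times> 'f \<Rightarrow> 'a \<times> 'f" where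
  "uzn_mult smul = (\<lambda>(a, c) (b, d). (a * b + smul c b + smul d a, c * d))"

definition uzn_star ::
  "('a \<Rightarrow> 'a) \<Rightarrow> 'a \<times> 'f::scalar_field \<Rightarrow> 'a \<times> 'f" where
  "uzn_star star = (\<lambda>(a, c). (star a, scnj c))"

definition uzn_norm ::
  "('f \<Rightarrow> 'a::real_normed_algebra \<Rightarrow> 'a) \<Rightarrow> 'a \<times> 'f \<Rightarrow> real" where
  "uzn_norm smul = (\<lambda>(a, c). SUP b\<in>{b. norm b \<le> 1}. norm (a * b + smul c b))"

definition real_rank_zero ::
  "('f::scalar_field \<Rightarrow> 'a::{real_normed_algebra, banach} \<Rightarrow> 'a) \<Rightarrow> ('a \<Rightarrow> 'a) \<Rightarrow> bool" where
  "real_rank_zero smul star \<longleftrightarrow>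
     (if \<exists>e::'a. unit_element e
      then \<forall>x::'a. star x = x \<longrightarrow> (\<forall>\<epsilon>>0. \<exists>y. star y = y
             \<and> (\<exists>z. unit_element (y * z) \<and> unit_element (z * y))
             \<and> norm (x - y) < \<epsilon>)
      else \<forall>x::'a \<times> 'f. uzn_star star x = x \<longrightarrow> (\<forall>\<epsilon>>0. \<exists>y. uzn_star star y = y
             \<and> (\<exists>z. uzn_mult smul y z = (0, 1) \<and> uzn_mult smul z y = (0, 1))
             \<and> uzn_norm smul (x - y) < \<epsilon>))"

definition proj_order :: "('a::times \<Rightarrow> 'a) \<Rightarrow> 'a gorder" where
  "proj_order star =
     \<lparr>carrier = {p. star p = p \<and> p * p = p}, eq = (=), le = (\<lambda>p q. p * q = p)\<rparr>"

definition atom :: "('a, 'b) gorder_scheme \<Rightarrow> 'a \<Rightarrow> bool" where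
  "atom L a \<longleftrightarrow> a \<in> carrier L - {\<bottom>\<^bsub>L\<^esub>} \<and> \<not> (\<exists>b\<in>carrier L - {\<bottom>\<^bsub>L\<^esub>}. b \<sqsubset>\<^bsub>L\<^esub> a)"

definition pregap :: "('a, 'b) gorder_scheme \<Rightarrow> 'a set \<Rightarrow> 'a set \<Rightarrow> bool" where
  "pregap L P Q \<longleftrightarrow>
     P \<subseteq> carrier L \<and> Q \<subseteq> carrier L \<and> (\<forall>p\<in>P. \<forall>q\<in>Q. p \<sqsubset>\<^bsub>L\<^esub> q)"

definition interpolates :: "('a, 'b) gorder_scheme \<Rightarrow> 'a \<Rightarrow> 'a set \<Rightarrow> 'a set \<Rightarrow> bool" where
  "interpolates L r P Q \<longleftrightarrow>
     r \<in> carrier L \<and> (\<forall>p\<in>P. p \<sqsubset>\<^bsub>L\<^esub> r) \<and> (\<forall>q\<in>Q. r \<sqsubset>\<^bsub>L\<^esub> q)"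

definition gap :: "('a, 'b) gorder_scheme \<Rightarrow> 'a set \<Rightarrow> 'a set \<Rightarrow> bool" where
  "gap L P Q \<longleftrightarrow> pregap L P Q \<and> \<not> (\<exists>r. interpolates L r P Q)"

definition omega_omega_gap :: "('a, 'b) gorder_scheme \<Rightarrow> 'a set \<Rightarrow> 'a set \<Rightarrow> bool" where
  "omega_omega_gap L P Q \<longleftrightarrow> gap L P Q \<and>
     (\<exists>(p :: nat \<Rightarrow> 'a) (q :: nat \<Rightarrow> 'a). P = range p \<and> Q = range q
        \<and> (\<forall>m n. m < n \<longrightarrow> p m \<sqsubset>\<^bsub>L\<^esub> p n) \<and> (\<forall>m n. m < n \<longrightarrow> q n \<sqsubset>\<^bsub>L\<^esub> q m))"

context cstar_algebra
begin

lemma partial_order_proj_order: "partial_order (proj_order star)"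
proof (unfold_locales, goal_cases)
  case (5 x y)
  then have "x * y = x" "y * x = y" "star x = x" "star y = y"
    by (simp_all add: proj_order_def)
  then show ?case
    using star_mult [of x y] by (simp add: proj_order_def)
next
  case (6 x y z)
  then show ?case
    by (simp add: proj_order_def) (metis mult.assoc)
qed (auto simp: proj_order_def)

lemma bottom_proj_order: "\<bottom>\<^bsub>proj_order star\<^esub> = 0"
proof -
  interpret P: partial_order "proj_order star"
    by (rule partial_order_proj_order)
  have "star 0 = 0"
    using star_add [of 0 0] by simp
  then have "least (proj_order star) 0 (carrier (proj_order star))"
    by (auto simp: least_def proj_order_def)
  then show ?thesis
    unfolding bottom_def by (metis P.least_unique someI_ex)
qed

end

end

theory Submission
  imports Defs
begin

text \<open>
  The key is that a countable set of projections has the same lower bounds as some decreasing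
  sequence of projections; by complementation inside one member of the upper set the same holds for
  upper bounds and increasing sequences.  So countable \<open>P \<le> Q\<close> always admit \<open>r\<close> with
  \<open>P \<le> r \<le> Q\<close>: if one of the two sequences is eventually constant take its last value, and
  otherwise thin both out to strictly monotone ones and use that they do not form a gap.  If
  \<open>(P, Q)\<close> is a gap, every such \<open>r\<close> lies in \<open>P \<union> Q\<close>, and since there are no atoms there is exactly
  one, say \<open>s\<close>.  For an upper bound \<open>u\<close> of \<open>P\<close>, the same applied to \<open>P\<close> and \<open>{s, u}\<close> gives \<open>s \<le> u\<close>,
  and dually for lower bounds of \<open>Q\<close>.
\<close>

text \<open>Two projections need not have a meet in \<open>A\<close>. Real rank zero supplies the
  substitute: a projection below one of them, nearly below the other, and still above every common
  lower bound of both. Meeting each member of the countable set infinitely often in this way, with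
  errors tending to 0, gives the decreasing sequence. As the scalars may be real and a unit may be
  missing, no spectra or positive cone are set up. Square roots come from contractions, inverses
  have the form \<open>1 + n\<close> with only \<open>n\<close> in the algebra, a projection serves
  as the unit of its corner, and comparison of positive elements is reduced to
  \<open>norm_square_le_sum\<close>.\<close>

lemma mult_assoc_lift: "a * b = c \<Longrightarrow> a * (b * z) = c * z" for a b c z :: "'a::semigroup_mult"
  by (simp flip: mult.assoc)

text \<open>Since there need not be a unit, \<open>pow1 x n\<close> stands for \<open>x ^ (n + 1)\<close>.\<close>
fun pow1 :: "'a::times \<Rightarrow> nat \<Rightarrow> 'a" where
  "pow1 x 0 = x"
| "pow1 x (Suc n) = x * pow1 x n"

lemma strictly_changing_subsequence:
  fixes f :: "nat \<Rightarrow> 'a"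
  assumes "\<And>N. \<exists>n>N. f n \<noteq> f N"
  obtains \<phi> :: "nat \<Rightarrow> nat" where "strict_mono \<phi>" "\<And>n. f (\<phi> (Suc n)) \<noteq> f (\<phi> n)"
proof -
  obtain g where g: "\<And>N. g N > N \<and> f (g N) \<noteq> f N" using assms by metis
  define \<phi> where "\<phi> n = (g ^^ n) 0" for n
  have "strict_mono \<phi>" "\<And>n. f (\<phi> (Suc n)) \<noteq> f (\<phi> n)"
    using g by (simp_all add: \<phi>_def strict_mono_Suc_iff)
  then show thesis using that by blast
qed

section \<open>The conjugation of the scalar field\<close>

lemma scnj_of_real: "scnj (of_real r :: 'f::scalar_field) = of_real r"
proof (cases "r = 0")
  case True
  have "scnj (0::'f) + scnj 0 = scnj 0" using scnj_add[of "0::'f" 0] by simp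
  then show ?thesis using True by simp
next
  case False
  have "scnj (of_real r :: 'f) * of_real r = of_real r * of_real r"
    using scnj_mult_self[of "of_real r :: 'f"]
    by (simp add: scaleR_conv_of_real power2_eq_square)
  then show ?thesis using False by simp
qed

text \<open>The square of such a \<open>d\<close> is that of its norm, and a field has no other
  roots than the two signs. This makes the scalar part of a self-adjoint element of the unitization
  real.\<close>

lemma scnj_fixed_real:
  fixes d :: "'f::scalar_field"
  assumes "scnj d = d"
  obtains t where "d = of_real t"
proof -
  have "d * d = of_real (norm d) * of_real (norm d)"
    using scnj_mult_self[of d] assms by (simp add: scaleR_conv_of_real power2_eq_square)
  then have "(d - of_real (norm d)) * (d + of_real (norm d)) = 0"
    by (simp add: algebra_simps)
  then have "d = of_real (norm d) \<or> d = of_real (- norm d)"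
    by (simp add: eq_neg_iff_add_eq_0)
  then show thesis using that by blast
qed

text \<open>What is needed of \<open>scnj\<close> follows from
  \<open>scnj x = of_real ((norm x)\<^sup>2) / x\<close>. The witness is the skew element
  \<open>c - scnj c\<close>, normalised.\<close>

lemma scnj_imaginary_unit:
  fixes c :: "'f::scalar_field"
  assumes "scnj c \<noteq> c"
  obtains i :: 'f where "i * i = -1" "scnj i = - i"
proof -
  have mi: "scnj (- x) = - scnj x" for x :: 'f
    using scnj_add[of x "- x"] scnj_of_real[of 0, where 'f = 'f]
    by (simp add: add_eq_0_iff)
  have sc: "scnj x = of_real ((norm x)\<^sup>2) / x" if "x \<noteq> 0" for x :: 'f
    using scnj_mult_self[of x] that by (simp add: scaleR_conv_of_real field_simps)
  have c0: "c \<noteq> 0" using assms scnj_of_real[of 0, where 'f = 'f] by auto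
  have n: "norm (scnj c) = norm c"
    using c0 by (simp add: sc norm_divide power2_eq_square norm_mult)
  then have "scnj c \<noteq> 0" using c0 by auto
  then have cc: "scnj (scnj c) = c"
    using c0 by (subst sc, simp, simp only: n) (simp add: sc)
  define d where "d = c - scnj c"
  have d0: "d \<noteq> 0" using assms by (simp add: d_def)
  have sd: "scnj d = - d"
    using scnj_add[of c "- scnj c"] by (simp add: d_def mi cc)
  have dd: "d * d = - of_real ((norm d)\<^sup>2)"
    using scnj_mult_self[of d] sd by (simp add: scaleR_conv_of_real minus_equation_iff[of "d * d"])
  define i where "i = d / of_real (norm d)"
  have ii: "i * i = -1" using d0 dd by (simp add: i_def power2_eq_square)
  have ni: "norm i = 1" using d0 by (simp add: i_def norm_divide)
  have i0: "i \<noteq> 0" using ni by auto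
  have "scnj i = 1 / i" using sc[OF i0] ni by simp
  also have "\<dots> = - i" using ii i0 by (simp add: field_simps)
  finally show thesis using that ii by blast
qed

subsection \<open>Square roots and sign decomposition\<close>

context cstar_algebra
begin

lemma star_scaleR: "star (r *\<^sub>R x) = r *\<^sub>R star x"
  by (metis scale_of_real scnj_of_real star_scale)

lemma star_zero [simp]: "star 0 = 0"
  using star_add [of 0 0] by simp

lemma star_minus: "star (- x) = - star x"
  using star_scaleR[of "-1" x] by simp

lemma star_diff: "star (x - y) = star x - star y"
  using star_add[of x "- y"] by (simp add: star_minus)

lemmas star_simps = star_star star_add star_mult star_scaleR star_minus star_diff

lemma norm_star: "norm (star x) = norm x"
proof -
  have le: "norm y \<le> norm (star y)" for y
  proof -
    have "norm y * norm y \<le> norm (star y) * norm y"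
      using cstar_identity[of y] norm_mult_ineq[of "star y" y] by (simp add: power2_eq_square)
    then show ?thesis by (cases "norm y = 0") (auto simp: mult_le_cancel_right)
  qed
  from le[of x] le[of "star x"] show ?thesis by (simp add: star_star)
qed

lemma norm_mult_self: "star x = x \<Longrightarrow> norm (x * x) = (norm x)\<^sup>2"
  using cstar_identity[of x] by simp

lemma mult_star_self_eq_0: "x * star x = 0 \<Longrightarrow> x = 0"
  using cstar_identity[of "star x"] by (simp add: star_star norm_star)

lemma bounded_linear_star: "bounded_linear star"
  by (rule bounded_linear_intro[of _ 1]) (simp_all add: star_add star_scaleR norm_star)

lemma continuous_star: "continuous_on S star"
  by (simp add: bounded_linear_star linear_continuous_on)

text \<open>Monotonicity of the norm on positive elements, in the commuting case. For nontrivial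
  conjugation, \<open>u = t + i s\<close> has \<open>star u * u = s * s + t * t\<close>, and
  \<open>s\<close> is its imaginary part, hence of no larger norm.\<close>

lemma norm_square_le_sum:
  assumes s: "star s = s" and t: "star t = t" and st: "s * t = t * s"
  shows "(norm s)\<^sup>2 \<le> norm (s * s + t * t)"
proof (cases "\<forall>c::'f. scnj c = c")
  case True
  then show ?thesis using real_cstar[of s t] s t by simp
next
  case False
  then obtain c :: 'f where "scnj c \<noteq> c" by blast
  then obtain i :: 'f where i: "i * i = -1" "scnj i = - i" by (rule scnj_imaginary_unit)
  have "norm i * norm i = 1" by (metis i(1) norm_minus_cancel norm_mult norm_one)
  then have ni: "norm i = 1" by (metis norm_ge_zero real_sqrt_abs2 real_sqrt_one abs_of_nonneg)
  define u where "u = t + smul i s"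
  have su: "star u = t - smul i s"
    by (simp add: u_def star_add star_scale t s i(2))
  have "star u * u = s * s + t * t"
    unfolding su unfolding u_def
    by (simp add: algebra_simps scale_mult_left scale_mult_right scale_scale i(1) st)
  then have nu: "(norm u)\<^sup>2 = norm (s * s + t * t)" by (metis cstar_identity)
  have "norm (smul i s + smul i s) = norm (u - star u)"
    by (simp only: su) (simp add: u_def)
  also have "\<dots> \<le> norm u + norm u"
    using norm_triangle_ineq4[of u "star u"] by (simp add: norm_star)
  finally have "norm (2 *\<^sub>R smul i s) \<le> 2 * norm u" by (simp add: scaleR_2)
  then have "norm s \<le> norm u" by (simp add: norm_scale ni)
  then show ?thesis unfolding nu[symmetric] by (simp add: power_mono)
qed

text \<open>In unital terms \<open>1 + n\<close> is the inverse of \<open>1 - k\<close>.\<close>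

lemma quasi_inverse:
  assumes k: "star k = k" "norm k \<le> 1/2"
  obtains n where "star n = n" "n = k + k * n" "norm n \<le> 2 * norm k"
proof -
  have "\<exists>!n\<in>UNIV. k + k * n = n"
  proof (rule Banach_fix[of UNIV "1/2"])
    show "dist (k + k * x) (k + k * y) \<le> 1/2 * dist x y" for x y
    proof -
      have "dist (k + k * x) (k + k * y) = norm (k * (x - y))"
        by (simp add: dist_norm algebra_simps)
      also have "\<dots> \<le> norm k * norm (x - y)" by (rule norm_mult_ineq)
      also have "\<dots> \<le> 1/2 * norm (x - y)" using k by (intro mult_right_mono) auto
      finally show "dist (k + k * x) (k + k * y) \<le> 1/2 * dist x y" by (simp add: dist_norm)
    qed
  qed (auto simp: complete_UNIV)
  then obtain n where n: "n = k + k * n" by metis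
  define n' where "n' = star n"
  have n': "n' = k + n' * k"
    using arg_cong[OF n, of star] by (simp add: n'_def star_simps k)
  have "k * n = n - k" "n' * k = n' - k" using n n' by (simp_all add: algebra_simps)
  \<comment> \<open>\<open>star n\<close> is a quasi-inverse from the other side, and associativity
    forces the two to agree.\<close>
  then have "n' * (n - k) = (n' - k) * n" by (metis mult.assoc)
  then have "n' * k = k * n" by (simp add: algebra_simps)
  then have "n' = n" using n n' by metis
  moreover have "norm n \<le> norm k + norm k * norm n"
    using n norm_triangle_ineq[of k "k * n"] norm_mult_ineq[of k n] by simp
  moreover have "norm k * norm n \<le> 1/2 * norm n" using k by (intro mult_right_mono) auto
  ultimately show thesis using that[of n] n by (simp add: n'_def)
qed

text \<open>\<open>1 - v\<close> is the square root of \<open>1 - w\<close>, with the unit cancelled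
  from \<open>(1 - v)^2 = 1 - w\<close>. The last two clauses are closed conditions preserved by the
  iteration, so they are built into the set \<open>S\<close> on which it contracts.\<close>

lemma half_sqrt:
  assumes w: "star w = w" "norm w < 1"
  obtains v where "star v = v" "norm v < 1" "v + v = w + v * v"
    "\<And>z. z * w = w * z \<Longrightarrow> z * v = v * z" "\<And>z. z * w = w \<Longrightarrow> z * v = v"
proof -
  define S where "S = cball 0 (norm w) \<inter> {v. star v = v} \<inter>
     (\<Inter>z\<in>{z. z * w = w * z}. {v. z * v = v * z}) \<inter> (\<Inter>z\<in>{z. z * w = w}. {v. z * v = v})"
  define F where "F = (\<lambda>v. (1/2) *\<^sub>R (w + v * v))"
  have nF: "v \<in> S \<Longrightarrow> norm v \<le> norm w" for v by (simp add: S_def)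
  have cl: "closed S"
    unfolding S_def
    by (intro closed_Int closed_INT ballI closed_Collect_eq continuous_intros continuous_star) auto
  have "\<exists>!v\<in>S. F v = v"
  proof (rule Banach_fix[of S "norm w"])
    show "complete S" using cl by (simp add: complete_eq_closed)
    have "0 \<in> S" by (simp add: S_def)
    then show "S \<noteq> {}" by blast
    show "F ` S \<subseteq> S"
    proof clarify
      fix v assume v: "v \<in> S"
      have "norm (w + v * v) \<le> norm w + norm v * norm v"
        using norm_triangle_ineq[of w "v * v"] norm_mult_ineq[of v v] by simp
      also have "norm v * norm v \<le> norm w * 1"
        using nF[OF v] w by (intro mult_mono) auto
      finally have 1: "norm (F v) \<le> norm w" by (simp add: F_def)
      have "star v = v" using v by (simp add: S_def)
      then have 2: "star (F v) = F v" using w by (simp add: F_def star_simps)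
      have 3: "z * F v = F v * z" if z: "z * w = w * z" for z
      proof -
        have "z * v = v * z" using v z by (simp add: S_def)
        then have "z * (v * v) = v * v * z" by (metis mult.assoc)
        then show ?thesis using z by (simp add: F_def distrib_left distrib_right)
      qed
      have 4: "z * F v = F v" if z: "z * w = w" for z
      proof -
        have "z * v = v" using v z by (simp add: S_def)
        then have "z * (v * v) = v * v" by (metis mult.assoc)
        then show ?thesis using z by (simp add: F_def distrib_left distrib_right)
      qed
      from 1 2 3 4 show "F v \<in> S" by (simp add: S_def)
    qed
    show "dist (F x) (F y) \<le> norm w * dist x y" if xy: "x \<in> S" "y \<in> S" for x y
    proof -
      have "F x - F y = (1/2) *\<^sub>R (x * (x - y) + (x - y) * y)"
        by (simp add: F_def algebra_simps)
      then have "dist (F x) (F y) = (1/2) * norm (x * (x - y) + (x - y) * y)"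
        by (simp add: dist_norm)
      also have "norm (x * (x - y) + (x - y) * y) \<le> norm x * norm (x - y) + norm (x - y) * norm y"
        by (intro order_trans[OF norm_triangle_ineq] add_mono norm_mult_ineq)
      also have "\<dots> \<le> norm w * norm (x - y) + norm (x - y) * norm w"
        using xy nF by (intro add_mono mult_mono) auto
      finally show "dist (F x) (F y) \<le> norm w * dist x y" by (simp add: dist_norm)
    qed
  qed (use w in auto)
  then obtain v where v: "v \<in> S" "F v = v" by blast
  have "v + v = 2 *\<^sub>R F v" by (simp add: v scaleR_2)
  then have "v + v = w + v * v" by (simp add: F_def)
  moreover have "star v = v" "norm v < 1"
    using v(1) nF[OF v(1)] w(2) by (simp_all add: S_def)
  moreover have "z * v = v * z" if "z * w = w * z" for z
    using v(1) that unfolding S_def by blast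
  moreover have "z * v = v" if "z * w = w" for z
    using v(1) that unfolding S_def by blast
  ultimately show thesis using that by blast
qed

text \<open>Here \<open>u\<close> plays the unit: \<open>half_sqrt\<close> for \<open>a / T\<close>
  yields \<open>u - v\<close> with square \<open>u - a / T\<close>, which is then rescaled by
  \<open>sqrt T\<close>.\<close>

lemma sqrt_scalar_diff:
  assumes u: "star u = u" "u * u = u" and a: "star a = a" "u * a = a" "norm a < T"
  obtains d where "star d = d" "u * d = d" "d * d = T *\<^sub>R u - a"
    "\<And>z. z * a = a * z \<Longrightarrow> z * u = u * z \<Longrightarrow> z * d = d * z"
proof -
  have T: "T > 0" using a norm_ge_zero[of a] by linarith
  have "star ((1/T) *\<^sub>R a) = (1/T) *\<^sub>R a" "norm ((1/T) *\<^sub>R a) < 1"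
    using a T by (simp_all add: star_simps)
  from half_sqrt[OF this] obtain v where v: "star v = v" "v + v = (1/T) *\<^sub>R a + v * v"
    and vc: "\<And>z. z * ((1/T) *\<^sub>R a) = ((1/T) *\<^sub>R a) * z \<Longrightarrow> z * v = v * z"
    and vu: "\<And>z. z * ((1/T) *\<^sub>R a) = (1/T) *\<^sub>R a \<Longrightarrow> z * v = v" by metis
  have uv: "u * v = v" using vu[of u] a by simp
  have "v * u = v" using arg_cong[OF uv, of star] by (simp add: star_simps u v)
  then have "(u - v) * (u - v) = u - (v + v) + v * v"
    using uv u by (simp add: algebra_simps)
  then have "(u - v) * (u - v) = u - (1/T) *\<^sub>R a" by (simp add: v(2))
  then have "(sqrt T *\<^sub>R (u - v)) * (sqrt T *\<^sub>R (u - v)) = T *\<^sub>R u - a"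
    using T by (simp only: mult_scaleR_left mult_scaleR_right) (simp add: scaleR_diff_right)
  moreover have "z * (sqrt T *\<^sub>R (u - v)) = (sqrt T *\<^sub>R (u - v)) * z"
    if "z * a = a * z" "z * u = u * z" for z
    using vc[of z] that by (simp add: right_diff_distrib left_diff_distrib)
  moreover have "star (sqrt T *\<^sub>R (u - v)) = sqrt T *\<^sub>R (u - v)"
    by (simp add: star_simps u v(1))
  moreover have "u * (sqrt T *\<^sub>R (u - v)) = sqrt T *\<^sub>R (u - v)"
    by (simp add: right_diff_distrib u uv)
  ultimately show thesis using that by blast
qed

lemma norm_proj_le:
  assumes "star u = u" "u * u = u" shows "norm u \<le> 1"
proof -
  have "norm u * norm u = norm u" using norm_mult_self[of u] assms by (simp add: power2_eq_square)
  then show ?thesis by (cases "norm u = 0") auto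
qed

text \<open>Positivity of \<open>c * c\<close> turns a two-sided estimate into
  \<open>0 \<le> c * c \<le> (T + s) u\<close>. The root \<open>d\<close> of
  \<open>T u - (c * c - s u)\<close> satisfies \<open>c * c + d * d = (T + s) u\<close>, so that
  both squares are bounded by \<open>norm_square_le_sum\<close>.\<close>

lemma norm_square_shift:
  assumes u: "star u = u" "u * u = u" and c: "star c = c" "u * c = c"
    and n: "norm (c * c - s *\<^sub>R u) < T"
  shows "norm (c * c) \<le> \<bar>T + s\<bar>" "norm ((T + s) *\<^sub>R u - c * c) \<le> \<bar>T + s\<bar>"
proof -
  define a where "a = c * c - s *\<^sub>R u"
  have cu: "c * u = c" using arg_cong[OF c(2), of star] by (simp add: star_mult u(1) c(1))
  have ucc: "u * (c * c) = c * c" by (metis c(2) mult.assoc)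
  have a: "star a = a" "u * a = a" "c * a = a * c"
    using u c cu ucc by (simp_all add: a_def star_simps algebra_simps)
  obtain d where d: "star d = d" "d * d = T *\<^sub>R u - a" "c * d = d * c"
    using sqrt_scalar_diff[OF u a(1,2) n[folded a_def]] a(3) cu c by metis
  have cd: "c * c + d * d = (T + s) *\<^sub>R u" by (simp add: d a_def algebra_simps)
  have nu: "norm ((T + s) *\<^sub>R u) \<le> \<bar>T + s\<bar>"
    using norm_proj_le[OF u] by (simp add: mult_left_le)
  show "norm (c * c) \<le> \<bar>T + s\<bar>"
    using norm_square_le_sum[OF c(1) d(1,3)] nu by (simp add: cd norm_mult_self c)
  have "norm (d * d) \<le> \<bar>T + s\<bar>"
    using norm_square_le_sum[OF d(1) c(1) d(3)[symmetric]] nu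
    by (simp add: add.commute[of "d * d"] cd norm_mult_self d(1))
  moreover have "d * d = (T + s) *\<^sub>R u - c * c" by (simp flip: cd)
  ultimately show "norm ((T + s) *\<^sub>R u - c * c) \<le> \<bar>T + s\<bar>" by simp
qed

text \<open>\<open>R * R\<close> is the absolute value of \<open>y\<close> and \<open>f\<close> its
  sign, in the corner with unit \<open>q\<close>, where \<open>v\<close> is the inverse of
  \<open>y\<close>. Taking the root of \<open>y * y\<close> requires a lower bound on it, which the
  inverse provides.\<close>

lemma sign_decomposition:
  assumes q: "star q = q" "q * q = q" and y: "star y = y" "q * y = y"
    and v: "q * v = v" "y * v = q"
  obtains f R where "star f = f" "star R = R" "q * f = f" "q * R = R" "f * f = q"
    "f * R = R * f" "y = f * (R * R)"
proof -
  have yq: "y * q = y" using arg_cong[OF y(2), of star] by (simp add: star_mult q(1) y(1))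
  have sv: "star v = v"
  proof -
    have 1: "star v * y = q" using arg_cong[OF v(2), of star] by (simp add: star_mult q(1) y(1))
    have 2: "star v * q = star v" using arg_cong[OF v(1), of star] by (simp add: star_mult q(1))
    have "v = star v * y * v" by (simp add: 1 v)
    then show ?thesis by (metis 2 mult.assoc v(2))
  qed
  have vq: "v * q = v" using arg_cong[OF v(1), of star] by (simp add: star_mult q(1) sv)
  have vy: "v * y = q" using arg_cong[OF v(2), of star] by (simp add: star_mult q(1) y(1) sv)
  have yyvv: "y * y * (v * v) = q" by (simp add: mult.assoc mult_assoc_lift[OF v(2)] v)
  \<comment> \<open>This \<open>t\<close> is small enough for \<open>q - t v^2\<close> to have a
    root \<open>c\<close>. Then \<open>b = y * c\<close> has square \<open>y^2 - t q\<close>, which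
    expresses \<open>t q \<le> y^2\<close>.\<close>
  define t where "t = 1 / (norm (v * v) + 1)"
  have t: "t > 0" by (simp add: t_def add_nonneg_pos)
  have tv: "star (t *\<^sub>R (v * v)) = t *\<^sub>R (v * v)" "q * (t *\<^sub>R (v * v)) = t *\<^sub>R (v * v)"
    "norm (t *\<^sub>R (v * v)) < 1"
    using v(1) by (simp_all add: star_simps sv mult.assoc[symmetric] t_def pos_divide_less_eq
        add_nonneg_pos)
  obtain c where c: "star c = c" "q * c = c" "c * c = 1 *\<^sub>R q - t *\<^sub>R (v * v)"
    and cc: "\<And>z. z * (t *\<^sub>R (v * v)) = t *\<^sub>R (v * v) * z \<Longrightarrow> z * q = q * z \<Longrightarrow> z * c = c * z"
    using sqrt_scalar_diff[OF q tv] by metis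
  have "y * (v * v) = v" "v * v * y = v" 
    by (simp_all add: mult.assoc mult_assoc_lift[OF v(2)] v vy vq)
  then have yc: "y * c = c * y" by (intro cc) (simp_all add: yq y)
  have vc: "v * c = c * v" by (intro cc) (simp_all add: vq v mult.assoc)
  have "(norm c)\<^sup>2 \<le> norm (c * c + (sqrt t *\<^sub>R v) * (sqrt t *\<^sub>R v))"
    by (intro norm_square_le_sum) (simp_all add: c star_simps sv vc)
  also have "c * c + (sqrt t *\<^sub>R v) * (sqrt t *\<^sub>R v) = q" using t by (simp add: c(3))
  finally have nc: "norm c \<le> 1" using norm_proj_le[OF q]
    by (intro power2_le_imp_le[of "norm c" 1]) auto
  define b where "b = y * c"
  have b: "star b = b" "q * b = b"
    by (simp_all add: b_def star_mult y c yc mult.assoc[symmetric]) 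
  have bq: "b * q = b" using arg_cong[OF b(2), of star] by (simp add: star_mult q(1) b(1))
  have "b * b = (y * y) * (c * c)" by (simp add: b_def mult.assoc mult_assoc_lift[OF yc])
  then have bb: "b * b = y * y - t *\<^sub>R q"
    by (simp add: c(3) right_diff_distrib yyvv) (simp add: mult.assoc yq)
  define \<alpha> where "\<alpha> = norm y * norm y + 1"
  have \<alpha>: "\<alpha> > 0" by (simp add: \<alpha>_def add_nonneg_pos)
  have "norm b \<le> norm y * 1"
    unfolding b_def by (intro order_trans[OF norm_mult_ineq] mult_left_mono nc) auto
  then have "norm b * norm b \<le> norm y * norm y" by (intro mult_mono) auto
  then have nb: "norm (b * b) < \<alpha>"
    using norm_mult_ineq[of b b] by (simp add: \<alpha>_def)
  have bbs: "star (b * b) = b * b" "q * (b * b) = b * b"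
    by (simp_all add: star_mult b mult.assoc[symmetric])
  obtain s where s: "star s = s" "s * s = \<alpha> *\<^sub>R q - b * b" "b * s = s * b"
    using sqrt_scalar_diff[OF q bbs nb] by (metis bq mult.assoc b(2))
  have "(norm s)\<^sup>2 \<le> norm (s * s + b * b)"
    by (intro norm_square_le_sum s b) (simp add: s)
  also have "s * s + b * b = \<alpha> *\<^sub>R q" by (simp add: s)
  also have "norm (\<alpha> *\<^sub>R q) \<le> \<alpha>" using \<alpha> norm_proj_le[OF q] by (simp add: mult_left_le)
  finally have ns: "norm (s * s) \<le> \<alpha>" by (simp add: norm_mult_self[OF s(1)])
  have ss: "s * s = (\<alpha> + t) *\<^sub>R q - y * y" by (simp add: s bb algebra_simps)
  \<comment> \<open>Equal to \<open>q - y^2 / (\<alpha> + t)\<close>, of norm at most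
    \<open>\<alpha> / (\<alpha> + t)\<close>. The lower bound \<open>t\<close> makes this less than
    1, as \<open>half_sqrt\<close> requires.\<close>
  define a where "a = (1 / (\<alpha> + t)) *\<^sub>R (s * s)"
  have a: "star a = a" "norm a < 1"
    using ns t \<alpha> by (simp_all add: a_def star_simps s(1) field_simps)
  have qa: "q * a = a" by (simp add: a_def ss right_diff_distrib q mult.assoc[symmetric] y)
  have va: "v * a = a * v"
  proof -
    have "v * (y * y) = y * y * v" by (simp add: mult.assoc mult_assoc_lift[OF vy] v y yq)
    then show ?thesis by (simp add: a_def ss right_diff_distrib left_diff_distrib v vq)
  qed
  obtain w where w: "star w = w" "norm w < 1" "w + w = a + w * w"
    and wc: "\<And>z. z * a = a * z \<Longrightarrow> z * w = w * z" and wa: "\<And>z. z * a = a \<Longrightarrow> z * w = w"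
    using half_sqrt[OF a] by metis
  have qw: "q * w = w" by (rule wa[OF qa])
  have wq: "w * q = w" using arg_cong[OF qw, of star] by (simp add: star_mult q(1) w(1))
  have vw: "v * w = w * v" by (rule wc[OF va])
  \<comment> \<open>The root of \<open>q - a\<close>, that is, the absolute value of
    \<open>y\<close> divided by \<open>sqrt (\<alpha> + t)\<close>.\<close>
  define S where "S = q - w"
  have S: "star S = S" "q * S = S" "S * q = S" "v * S = S * v"
    by (simp_all add: S_def star_simps q w right_diff_distrib left_diff_distrib qw wq vw v vq)
  have "S * S = q - (w + w) + w * w"
    by (simp add: S_def right_diff_distrib left_diff_distrib q qw wq)
  then have "S * S = q - a" by (simp add: w(3))
  then have SS: "(\<alpha> + t) *\<^sub>R (S * S) = y * y"
    using \<alpha> t by (simp add: a_def ss scaleR_diff_right)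
  obtain R0 where R0: "star R0 = R0" "q * R0 = R0" "R0 * R0 = 1 *\<^sub>R q - w"
    and R0c: "\<And>z. z * w = w * z \<Longrightarrow> z * q = q * z \<Longrightarrow> z * R0 = R0 * z"
    using sqrt_scalar_diff[OF q w(1) qw w(2)] by metis
  have RR: "R0 * R0 = S" by (simp add: R0 S_def)
  have vR: "v * R0 = R0 * v" by (rule R0c) (simp_all add: vw v vq)
  have SR: "S * R0 = R0 * S" by (simp add: RR[symmetric] mult.assoc)
  define \<kappa> where "\<kappa> = sqrt (\<alpha> + t)"
  have \<kappa>: "\<kappa> * \<kappa> = \<alpha> + t" "\<kappa> > 0" using \<alpha> t by (simp_all add: \<kappa>_def)
  define f where "f = \<kappa> *\<^sub>R (S * v)"
  define R where "R = sqrt \<kappa> *\<^sub>R R0"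
  have Rsq: "R * R = \<kappa> *\<^sub>R S" using \<kappa> by (simp add: R_def RR)
  have "(S * v) * (S * v) = (S * S) * (v * v)"
    by (simp add: mult.assoc mult_assoc_lift[OF S(4)])
  then have "f * f = (\<alpha> + t) *\<^sub>R (S * S) * (v * v)" by (simp add: f_def \<kappa>)
  then have ff: "f * f = q" by (simp only: SS yyvv)
  have "(S * v) * S = (S * S) * v" by (simp add: mult.assoc S(4))
  then have "f * (R * R) = (\<alpha> + t) *\<^sub>R (S * S) * v" by (simp add: f_def Rsq \<kappa>)
  then have yf: "y = f * (R * R)" by (simp only: SS mult.assoc v yq)
  have "star f = f" by (simp add: f_def star_simps S sv)
  moreover have "star R = R" by (simp add: R_def star_simps R0)
  moreover have "q * f = f" "q * R = R"
    by (simp_all add: f_def R_def R0 mult.assoc[symmetric] S)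
  moreover have "f * R = R * f"
  proof -
    have "S * v * R0 = R0 * (S * v)" by (simp add: mult.assoc vR mult_assoc_lift[OF SR])
    then show ?thesis by (simp add: f_def R_def)
  qed
  ultimately show thesis using that ff yf by metis
qed

subsection \<open>Invertible elements of corners\<close>

lemma left_unit_imp_unit:
  fixes e :: 'a assumes "\<And>z. e * z = z" shows "unit_element e"
proof -
  have r: "z * star e = z" for z
    using arg_cong[OF assms[of "star z"], of star] by (simp add: star_simps)
  have "star e = e" using assms[of "star e"] r[of e] by simp
  then show ?thesis using assms r by (metis unit_element_def)
qed

text \<open>If left multiplication by \<open>u\<close> were within distance \<open>< 1\<close> of the identity, then it would be
  invertible, and the solution of \<open>u * e = u\<close> would be a left unit.\<close>
lemma approximate_unit_imp_unit:
  fixes u :: 'a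
  assumes "\<rho> < 1" and near: "\<And>z. norm (u * z - z) \<le> \<rho> * norm z"
  shows "\<exists>e::'a. unit_element e"
proof (cases "\<rho> \<ge> 0")
  case True
  have "\<exists>!e\<in>UNIV. e - u * e + u = e"
  proof (rule Banach_fix[of UNIV \<rho>])
    show "dist (x - u * x + u) (y - u * y + u) \<le> \<rho> * dist x y" for x y
    proof -
      have "x - u * x + u - (y - u * y + u) = (x - y) - u * (x - y)" 
        by (simp only: right_diff_distrib) simp
      then have "dist (x - u * x + u) (y - u * y + u) = norm (u * (x - y) - (x - y))"
        by (simp only: dist_norm norm_minus_commute)
      then show ?thesis using near[of "x - y"] by (simp add: dist_norm)
    qed
  qed (use True assms in \<open>auto simp: complete_UNIV\<close>)
  then obtain e where "e - u * e + u = e" by blast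
  then have e: "u * e = u" by (simp add: algebra_simps)
  have "e * z = z" for z
  proof -
    have "u * (e * z - z) = 0" by (simp add: right_diff_distrib e flip: mult.assoc)
    then have "norm (e * z - z) \<le> \<rho> * norm (e * z - z)" using near[of "e * z - z"]
      by (simp add: norm_minus_commute)
    then have "(1 - \<rho>) * norm (e * z - z) \<le> 0" by (simp add: algebra_simps)
    then have "norm (e * z - z) \<le> 0" using assms(1) by (simp add: mult_le_0_iff)
    then show ?thesis by simp
  qed
  then have "unit_element e" by (rule left_unit_imp_unit)
  then show ?thesis ..
next
  \<comment> \<open>A negative \<open>\<rho>\<close> is possible only in the zero algebra, where 0
    is a unit.\<close>
  case False
  have "norm z = 0" for z :: 'a
  proof -
    have "0 \<le> \<rho> * norm z" by (rule order_trans[OF norm_ge_zero near])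
    then show ?thesis using False by (simp add: zero_le_mult_iff)
  qed
  then have "x = y" for x y :: 'a by (metis norm_eq_zero)
  then show ?thesis unfolding unit_element_def by blast
qed

text \<open>If the scalar part exceeded \<theta>, then left multiplication by \<open>- k / t\<close>
  would be close enough to the identity for \<open>approximate_unit_imp_unit\<close> to produce a
  unit.\<close>

lemma norm_le_uzn_norm:
  assumes nu: "\<not> (\<exists>e::'a. unit_element e)"
    and N: "uzn_norm smul (k, of_real t) \<le> \<theta>"
  shows "\<bar>t\<bar> \<le> \<theta>" "norm k \<le> 2 * \<theta>"
proof -
  have le: "norm (k * z + t *\<^sub>R z) \<le> \<theta> * norm z" for z
  proof (cases "z = 0")
    case False
    define b where "b = (1 / norm z) *\<^sub>R z"
    have nb: "norm b \<le> 1" using False by (simp add: b_def)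
    have "bdd_above ((\<lambda>b. norm (k * b + smul (of_real t) b)) ` {b. norm b \<le> 1})"
    proof (rule bdd_aboveI2)
      fix b :: 'a assume "b \<in> {b. norm b \<le> 1}"
      then have b: "norm b \<le> 1" by simp
      have "norm (k * b + t *\<^sub>R b) \<le> norm k * norm b + \<bar>t\<bar> * norm b"
        by (rule order_trans[OF norm_triangle_ineq]) (simp add: norm_mult_ineq)
      also have "\<dots> \<le> norm k * 1 + \<bar>t\<bar> * 1" using b by (intro add_mono mult_left_mono) auto
      finally show "norm (k * b + smul (of_real t) b) \<le> norm k + \<bar>t\<bar>" by (simp add: scale_of_real)
    qed
    then have "norm (k * b + smul (of_real t) b) \<le> uzn_norm smul (k, of_real t)"
      unfolding uzn_norm_def using nb by (auto intro: cSUP_upper)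
    also have "k * b + smul (of_real t) b = (1 / norm z) *\<^sub>R (k * z + t *\<^sub>R z)"
      by (simp add: b_def scale_of_real scaleR_add_right)
    finally have "norm (k * z + t *\<^sub>R z) / norm z \<le> \<theta>" using N by simp
    then show ?thesis using False by (simp add: pos_divide_le_eq)
  qed auto
  have t0: "\<theta> \<ge> 0"
  proof -
    obtain z :: 'a where "z \<noteq> 0" using nu unfolding unit_element_def by metis
    then show ?thesis using order_trans[OF norm_ge_zero le[of z]] by (simp add: zero_le_mult_iff)
  qed
  show t: "\<bar>t\<bar> \<le> \<theta>"
  proof (rule ccontr)
    assume "\<not> ?thesis"
    then have lt: "\<theta> < \<bar>t\<bar>" "t \<noteq> 0" using t0 by auto
    define u where "u = (- 1 / t) *\<^sub>R k"
    have "norm (u * z - z) \<le> (\<theta> / \<bar>t\<bar>) * norm z" for z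
    proof -
      have "u * z - z = (- 1 / t) *\<^sub>R (k * z + t *\<^sub>R z)"
        using lt by (simp add: u_def scaleR_add_right)
      then have "norm (u * z - z) = norm (k * z + t *\<^sub>R z) / \<bar>t\<bar>" by simp
      then show ?thesis using le[of z] lt by (simp add: divide_right_mono)
    qed
    moreover have "\<theta> / \<bar>t\<bar> < 1" using lt by simp
    ultimately show False using approximate_unit_imp_unit nu by blast
  qed
  \<comment> \<open>Testing on \<open>star k\<close> recovers the norm of \<open>k\<close> through
    the C*-identity.\<close>
  have "norm (k * star k) \<le> norm (k * star k + t *\<^sub>R star k) + norm (t *\<^sub>R star k)"
    using norm_triangle_ineq4[of "k * star k + t *\<^sub>R star k" "t *\<^sub>R star k"] by simp
  also have "\<dots> \<le> \<theta> * norm k + \<theta> * norm k"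
    using le[of "star k"] t by (intro add_mono) (simp_all add: norm_star mult_right_mono)
  finally have "norm k * norm k \<le> 2 * \<theta> * norm k"
    using cstar_identity[of "star k"] by (simp add: star_star norm_star power2_eq_square)
  then show "norm k \<le> 2 * \<theta>" using t0 by (cases "norm k = 0") (auto simp: mult_le_cancel_right)
qed

text \<open>The conditions on \<open>b\<close> and \<open>c\<close> say that \<open>1 + c\<close> is the inverse of \<open>1 + b\<close>; in this form
  they make sense whether or not the algebra has a unit.\<close>
lemma quasi_invertible_dense:
  assumes rr0: "real_rank_zero smul star" and x: "star x = x" and \<epsilon>: "\<epsilon> > 0"
  obtains b c where "star b = b" "norm (x - b) < \<epsilon>" "b + c + b * c = 0"
proof (cases "\<exists>e::'a. unit_element e")
  case True
  then obtain e :: 'a where "unit_element e" by blast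
  then have e: "e * z = z" "z * e = z" for z by (simp_all add: unit_element_def)
  have se: "star e = e" by (metis e star_mult star_star)
  have "star (e + x) = e + x" by (simp add: star_add se x)
  then obtain y z where y: "star y = y" "unit_element (y * z)" "norm (e + x - y) < \<epsilon>"
    using rr0 True \<epsilon> unfolding real_rank_zero_def by (simp only: if_True) blast
  have yz: "y * z = e" using y(2) e by (metis unit_element_def)
  show thesis
  proof (rule that[of "y - e" "z - e"])
    show "star (y - e) = y - e" by (simp add: star_simps se y)
    show "norm (x - (y - e)) < \<epsilon>" using y(3) by (simp add: algebra_simps)
    show "y - e + (z - e) + (y - e) * (z - e) = 0"
      by (simp add: algebra_simps e yz)
  qed
next
  case False
  \<comment> \<open>The invertible element has scalar part \<open>t\<close> within \<theta> of 1 and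
    is divided by \<open>t\<close>. With \<open>t \<ge> 1/2\<close> the total error is at most
    \<open>\<theta> * (2 * norm x + 4)\<close>, half of what this choice allows.\<close>
  define \<theta> where "\<theta> = min (1/2) (\<epsilon> / (4 * norm x + 8))"
  have \<theta>: "0 < \<theta>" "\<theta> \<le> 1/2" "\<theta> \<le> \<epsilon> / (4 * norm x + 8)"
    using \<epsilon> unfolding \<theta>_def by (simp add: add_nonneg_pos, linarith, linarith)
  then have \<theta>': "\<theta> * (4 * norm x + 8) \<le> \<epsilon>"
    by (simp add: pos_le_divide_eq add_nonneg_pos)
  have "uzn_star star (x, 1 :: 'f) = (x, 1)"
    using scnj_of_real[of 1, where 'f = 'f] by (simp add: uzn_star_def x)
  then obtain y z where y: "uzn_star star y = y" "uzn_mult smul y z = (0, 1)"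
    "uzn_norm smul ((x, 1 :: 'f) - y) < \<theta>"
    using rr0 False \<theta>(1) unfolding real_rank_zero_def by (simp only: if_False) blast
  obtain b0 d where yd: "y = (b0, d)" by (cases y)
  obtain c0 g where zd: "z = (c0, g)" by (cases z)
  have b0: "star b0 = b0" "scnj d = d" using y(1) by (simp_all add: yd uzn_star_def)
  obtain t where t: "d = of_real t" using scnj_fixed_real[OF b0(2)] .
  have inv: "b0 * c0 + t *\<^sub>R c0 + smul g b0 = 0" "d * g = 1"
    using y(2) by (simp_all add: yd zd uzn_mult_def t scale_of_real)
  then have t0: "t \<noteq> 0" using t by auto
  have sg: "smul g b0 = (1 / t) *\<^sub>R b0"
    unfolding scale_of_real[symmetric] using inv(2) t t0 by (simp add: field_simps)
  have "uzn_norm smul (x - b0, of_real (1 - t)) \<le> \<theta>" using y(3) by (simp add: yd t)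
  note n = norm_le_uzn_norm[OF False this]
  have "t \<ge> 1/2" using n(1) \<theta> by linarith
  then have t1: "\<bar>1 / t\<bar> \<le> 2" by (simp add: field_simps)
  show thesis
  proof (rule that[of "(1 / t) *\<^sub>R b0" "t *\<^sub>R c0"])
    show "star ((1 / t) *\<^sub>R b0) = (1 / t) *\<^sub>R b0" by (simp add: star_scaleR b0)
    have "norm b0 \<le> norm x + norm (x - b0)" using norm_triangle_ineq4[of x "x - b0"] by simp
    then have nb: "norm b0 \<le> norm x + 1" using n(2) \<theta> by linarith
    have "x - (1 / t) *\<^sub>R b0 = (x - b0) + (1 / t * (t - 1)) *\<^sub>R b0"
      using t0 by (simp add: algebra_simps diff_divide_distrib)
    then have "norm (x - (1 / t) *\<^sub>R b0) \<le> norm (x - b0) + norm ((1 / t * (t - 1)) *\<^sub>R b0)"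
      by (metis norm_triangle_ineq)
    also have "\<dots> = norm (x - b0) + \<bar>1 / t\<bar> * \<bar>1 - t\<bar> * norm b0"
      by (simp add: abs_mult abs_minus_commute)
    also have "\<dots> \<le> 2 * \<theta> + 2 * \<theta> * (norm x + 1)"
      using n t1 nb \<theta> by (intro add_mono mult_mono) auto
    also have "\<dots> = \<theta> * (2 * norm x + 4)" by (simp add: algebra_simps)
    also have "\<dots> < \<theta> * (4 * norm x + 8)"
      using \<theta>(1) norm_ge_zero[of x] by (intro mult_strict_left_mono) linarith+
    finally show "norm (x - (1 / t) *\<^sub>R b0) < \<epsilon>" using \<theta>' by linarith
    show "(1 / t) *\<^sub>R b0 + t *\<^sub>R c0 + (1 / t) *\<^sub>R b0 * t *\<^sub>R c0 = 0"
      using inv(1) t0 by (simp add: sg add.commute add.left_commute)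
  qed
qed

text \<open>If \<open>1 + b\<close> is an invertible element close to \<open>x + (1 - q)\<close>, then the Schur complement in
  \<open>1 + b\<close> of its block \<open>(1 - q) (1 + b) (1 - q)\<close> is invertible in the corner, its inverse being the
  \<open>q\<close>-block of \<open>(1 + b)\<inverse>\<close>.\<close>
lemma invertible_dense_corner:
  assumes rr0: "real_rank_zero smul star" and q: "star q = q" "q * q = q"
    and x: "star x = x" "q * x = x" and \<epsilon>: "\<epsilon> > 0"
  obtains y v where "star y = y" "q * y = y" "q * v = v" "y * v = q" "norm (x - y) < \<epsilon>"
proof -
  have xq: "x * q = x" using arg_cong[OF x(2), of star] by (simp add: star_mult q(1) x(1))
  note nq = norm_proj_le[OF q]
  \<comment> \<open>The error at the end is \<open>\<eta> + 8 * \<eta>^2\<close>, which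
    \<open>\<eta> \<le> 1/8\<close> bounds by \<open>2 * \<eta>\<close>.\<close>
  define \<eta> where "\<eta> = min (1/8) (\<epsilon> / 4)"
  have \<eta>: "0 < \<eta>" "\<eta> \<le> 1/8" "\<eta> \<le> \<epsilon> / 4" using \<epsilon> by (auto simp: \<eta>_def)
  have "star (x - q) = x - q" by (simp add: star_simps x q)
  then obtain b c where b: "star b = b" "norm (x - q - b) < \<eta>" "b + c + b * c = 0"
    using quasi_invertible_dense[OF rr0 _ \<eta>(1)] by metis
  define k where "k = b - (x - q)"
  have k: "star k = k" "norm k < \<eta>"
    using b(2) by (simp_all add: k_def star_simps b x q norm_minus_commute)
  have nqk: "norm (q * k) \<le> \<eta>" "norm (k * q) \<le> \<eta>"
    using mult_mono[OF nq less_imp_le[OF k(2)]] mult_mono[OF less_imp_le[OF k(2)] nq]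
      norm_mult_ineq[of q k] norm_mult_ineq[of k q] \<eta> by auto
  have nqkq: "norm (q * k * q) \<le> \<eta>"
    using mult_mono[OF nqk(1) nq] norm_mult_ineq[of "q * k" q] \<eta> by auto
  \<comment> \<open>The blocks \<open>q k (1 - q)\<close>, \<open>(1 - q) k q\<close> and
    \<open>(1 - q) k (1 - q)\<close>, written without a unit.\<close>
  define l where "l = q * k - q * k * q"
  define m where "m = k * q - q * k * q"
  define h where "h = k - q * k - k * q + q * k * q"
  have lm: "star l = m" "q * l = l" "l * q = 0" "m * q = m" "q * m = 0"
    by (simp_all add: l_def m_def star_simps q k right_diff_distrib left_diff_distrib mult.assoc
        mult_assoc_lift[OF q(2)])
  have nl: "norm l \<le> 2 * \<eta>" "norm m \<le> 2 * \<eta>"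
    using norm_triangle_ineq4[of "q * k" "q * k * q"] norm_triangle_ineq4[of "k * q" "q * k * q"]
      nqk nqkq by (simp_all add: l_def m_def)
  have h: "star h = h" "q * h = 0" "h * q = 0"
    by (simp_all add: h_def star_simps q k right_diff_distrib left_diff_distrib distrib_left
        distrib_right mult.assoc mult_assoc_lift[OF q(2)])
  have "norm h \<le> norm k + norm (q * k) + norm (k * q) + norm (q * k * q)"
    unfolding h_def by norm
  then have nh: "norm h \<le> 1/2" using k nqk nqkq \<eta> by linarith
  have "star (- h) = - h" "norm (- h) \<le> 1/2" using h nh by (simp_all add: star_minus)
  \<comment> \<open>\<open>1 + n\<close> is the inverse of \<open>1 + h\<close>.\<close>
  from quasi_inverse[OF this]
  obtain n where n: "star n = n" "n = - h + (- h) * n" "norm n \<le> 2 * norm (- h)" by metis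
  have nn: "norm n \<le> 1" using n(3) nh by simp
  have qn: "q * n = 0"
    by (subst n(2)) (simp add: right_diff_distrib h flip: mult.assoc)
  define \<beta> where "\<beta> = q * b * q"
  have \<beta>: "q * \<beta> = \<beta>" "\<beta> * q = \<beta>" "star \<beta> = \<beta>"
    by (simp_all add: \<beta>_def star_simps q b mult.assoc mult_assoc_lift[OF q(2)])
  have \<beta>k: "\<beta> = x - q + q * k * q"
    by (simp add: \<beta>_def k_def right_diff_distrib left_diff_distrib mult.assoc q x xq)
  have bdec: "b = \<beta> + l + m + h"
    by (simp add: \<beta>k l_def m_def h_def k_def)
  have qb: "q * b = \<beta> + l"
    by (simp add: bdec distrib_left \<beta> lm h)
  define \<gamma> where "\<gamma> = q * c * q"
  define \<mu> where "\<mu> = c * q - q * c * q"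
  have \<gamma>\<mu>: "q * \<gamma> = \<gamma>" "\<gamma> * q = \<gamma>" "q * \<mu> = 0" "\<mu> * q = \<mu>" "c * q = \<gamma> + \<mu>"
    by (simp_all add: \<gamma>_def \<mu>_def right_diff_distrib left_diff_distrib mult.assoc q
        mult_assoc_lift[OF q(2)])
  have z: "l * \<gamma> = 0" "h * \<gamma> = 0" "\<beta> * \<mu> = 0" "m * \<mu> = 0"
    using mult_assoc_lift[OF lm(3), of \<gamma>] mult_assoc_lift[OF h(3), of \<gamma>]
      mult_assoc_lift[OF \<beta>(2), of \<mu>] mult_assoc_lift[OF lm(4), of \<mu>] by (simp_all add: \<gamma>\<mu>)
  have bq: "b * q = \<beta> + m" by (simp add: bdec distrib_right \<beta> lm h)
  \<comment> \<open>Compressing the resulting equation \<open>E\<close> by \<open>q\<close> gives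
    \<open>E1\<close>, and the remainder is the \<open>(1 - q)\<close>-row
    \<open>E2\<close>.\<close>
  have "(b + c + b * c) * q = 0" using b(3) by simp
  then have E: "\<beta> + m + \<gamma> + \<mu> + \<beta> * \<gamma> + l * \<mu> + m * \<gamma> + h * \<mu> = 0"
    by (simp add: distrib_right distrib_left mult.assoc \<gamma>\<mu>(5) bq) (simp add: bdec distrib_right z algebra_simps)
  have "q * (\<beta> + m + \<gamma> + \<mu> + \<beta> * \<gamma> + l * \<mu> + m * \<gamma> + h * \<mu>) = 0" by (simp add: E)
  then have E1: "\<beta> + \<gamma> + \<beta> * \<gamma> + l * \<mu> = 0"
    by (simp add: distrib_left \<beta> \<gamma>\<mu> lm h flip: mult.assoc)
  have "\<beta> + m + \<gamma> + \<mu> + \<beta> * \<gamma> + l * \<mu> + m * \<gamma> + h * \<mu>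
     = (\<beta> + \<gamma> + \<beta> * \<gamma> + l * \<mu>) + (m + m * \<gamma> + \<mu> + h * \<mu>)" by (simp add: algebra_simps)
  with E E1 have E2: "m + m * \<gamma> + \<mu> + h * \<mu> = 0" by simp
  \<comment> \<open>The Schur complement \<open>(q + \<beta>) - l (1 + h)^(-1) m\<close>.\<close>
  define y where "y = q + \<beta> - l * m - l * n * m"
  define v where "v = q + \<gamma>"
  have sm: "star m = l" using lm(1) by (metis star_star)
  have y: "star y = y" "q * y = y"
    by (simp_all add: y_def star_simps q \<beta> lm sm n(1) mult.assoc right_diff_distrib distrib_left)
      (simp add: lm flip: mult.assoc)
  have v: "q * v = v" by (simp add: v_def distrib_left q \<gamma>\<mu>)
  have mg: "m + m * \<gamma> = - (\<mu> + h * \<mu>)" using E2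
    by (simp only: eq_neg_iff_add_eq_0 add.assoc)
  have bg: "\<beta> + \<gamma> + \<beta> * \<gamma> = - (l * \<mu>)" using E1
    by (simp only: eq_neg_iff_add_eq_0)
  have "y * v = q + (\<beta> + \<gamma> + \<beta> * \<gamma>) - l * (m + m * \<gamma>) - l * n * (m + m * \<gamma>)"
    by (simp add: y_def v_def algebra_simps q \<gamma>\<mu> \<beta> lm)
  also have "\<dots> = q + - (l * \<mu>) - l * - (\<mu> + h * \<mu>) - l * n * - (\<mu> + h * \<mu>)"
    by (simp only: mg bg)
  also have "\<dots> = q + l * (h + n + n * h) * \<mu>" by (simp add: algebra_simps)
  finally have "y * v = q + l * (h + n + n * h) * \<mu>" .
  moreover have "n + h + n * h = 0"
    using arg_cong[OF n(2), of star] by (simp add: star_simps n(1) h(1) eq_diff_eq add_ac)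
  ultimately have yv: "y * v = q" by (simp add: add.commute)
  have "x - y = - (q * k * q) + l * m + l * n * m" by (simp add: y_def \<beta>k)
  moreover have "norm (l * m) \<le> (2 * \<eta>) * (2 * \<eta>)"
    using nl \<eta> by (intro order_trans[OF norm_mult_ineq] mult_mono) auto
  moreover have "norm (l * n * m) \<le> (2 * \<eta> * 1) * (2 * \<eta>)"
    using nl \<eta> nn by (intro order_trans[OF norm_mult_ineq] mult_mono order_trans[OF norm_mult_ineq]) auto
  ultimately have "norm (x - y) \<le> \<eta> + (2 * \<eta>) * (2 * \<eta>) + (2 * \<eta>) * (2 * \<eta>)"
    using norm_triangle_ineq[of "- (q * k * q) + l * m" "l * n * m"]
      norm_triangle_ineq[of "- (q * k * q)" "l * m"] nqkq by simp
  also have "\<dots> = \<eta> + \<eta> * (8 * \<eta>)" by simp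
  also have "\<dots> \<le> \<eta> + \<eta> * 1" using \<eta> by (intro add_left_mono mult_left_mono) auto
  also have "\<dots> < \<epsilon>" using \<eta> \<epsilon> by simp
  finally show thesis using that y v yv by blast
qed

subsection \<open>Approximate meets of projections\<close>

text \<open>Up to the error \<open>k\<close>, \<open>x\<close> acts on the range of \<open>e\<close>
  as the contraction \<open>a\<close>. Since \<open>norm x \<le> 1\<close>, each further factor adds
  at most one \<open>\<eta>\<close>; the exponent is \<open>Suc n\<close> because
  \<open>pow1 x n\<close> has \<open>n + 1\<close> factors.\<close>

lemma pow1_mult_le:
  fixes x e a k :: 'a and \<rho> \<eta> :: real
  assumes x: "norm x \<le> 1" and xe: "x * e = a + k" and ea: "e * a = a"
    and a: "norm a \<le> \<rho>" "\<rho> \<le> 1" and k: "norm k \<le> \<eta>"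
  shows "norm (pow1 x n * e) \<le> \<rho> ^ Suc n + Suc n * \<eta>"
proof -
  have "norm (pow1 a n) \<le> \<rho> ^ Suc n" for n
  proof (induction n)
    case (Suc n)
    have "0 \<le> \<rho>" using a norm_ge_zero order_trans by blast
    then have "norm (a * pow1 a n) \<le> \<rho> * \<rho> ^ Suc n"
      using a Suc by (intro order_trans[OF norm_mult_ineq] mult_mono) auto
    then show ?case by simp
  qed (use a in simp)
  note na = this
  have ep: "e * pow1 a n = pow1 a n" for n
    by (cases n) (simp_all add: ea flip: mult.assoc)
  have "norm (pow1 x n * e - pow1 a n) \<le> Suc n * \<eta>"
  proof (induction n)
    case 0
    then show ?case using k by (simp add: xe)
  next
    case (Suc n)
    have "x * pow1 a n = (x * e) * pow1 a n" by (simp add: ep mult.assoc)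
    then have "pow1 x (Suc n) * e - pow1 a (Suc n)
        = x * (pow1 x n * e - pow1 a n) + k * pow1 a n"
      by (simp add: xe algebra_simps)
    moreover have "norm (x * (pow1 x n * e - pow1 a n)) \<le> 1 * (Suc n * \<eta>)"
      using x Suc by (intro order_trans[OF norm_mult_ineq] mult_mono) auto
    moreover have "norm (k * pow1 a n) \<le> \<eta> * 1"
    proof -
      have "norm (pow1 a n) \<le> 1"
        using na[of n] a norm_ge_zero[of a] power_le_one[of \<rho> "Suc n"] by linarith
      then show ?thesis
        using k order_trans[OF norm_ge_zero k] by (intro order_trans[OF norm_mult_ineq] mult_mono) auto
    qed
    ultimately show ?case
      using norm_triangle_ineq[of "x * (pow1 x n * e - pow1 a n)" "k * pow1 a n"]
      by (simp add: algebra_simps)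
  qed
  then show ?thesis using na[of n] norm_triangle_ineq2[of "pow1 x n * e" "pow1 a n"] by linarith
qed

text \<open>The projection onto the range of \<open>T\<close>, where \<open>T * e = T\<close> is a small perturbation of \<open>e\<close>, is
  \<open>T m T\<^sup>*\<close> with \<open>m\<close> the inverse of \<open>T\<^sup>* T\<close> in the corner of \<open>e\<close>.\<close>
lemma range_projection:
  assumes e: "star e = e" "e * e = e" and T: "T * e = T" "norm (T - e) \<le> \<gamma>" and \<gamma>: "\<gamma> \<le> 1/6"
  obtains e' n where "star e' = e'" "e' * e' = e'" "e' = T * n" "norm (e' - e) \<le> 27 * \<gamma>"
proof -
  note ne = norm_proj_le[OF e]
  have \<gamma>0: "\<gamma> \<ge> 0" using T(2) norm_ge_zero order_trans by blast
  have eT: "e * star T = star T" using arg_cong[OF T(1), of star] by (simp add: star_mult e(1))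
  have nT: "norm T \<le> 2" using norm_triangle_ineq2[of T e] T(2) ne \<gamma> by linarith
  have nT': "norm (e - T) \<le> \<gamma>" using T(2) by (simp add: norm_minus_commute)
  have nTs: "norm (e - star T) \<le> \<gamma>"
    using T(2) norm_star[of "T - e"] by (simp add: star_simps e norm_minus_commute)
  \<comment> \<open>The defect of \<open>T\<close> from being isometric on \<open>e\<close>. The
    bound 1/6 keeps its norm at most 1/2, so that \<open>e - w\<close> has the inverse
    \<open>e + n\<close> in the corner.\<close>
  define w where "w = e - star T * T"
  have w: "star w = w" "e * w = w"
    by (simp_all add: w_def star_simps e eT right_diff_distrib flip: mult.assoc)
  have we: "w * e = w" using arg_cong[OF w(2), of star] by (simp add: star_mult e(1) w(1))
  have "w = (e - star T) * e + star T * (e - T)" by (simp add: w_def algebra_simps e)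
  moreover have "norm ((e - star T) * e) \<le> \<gamma> * 1"
    using nTs ne \<gamma>0 by (intro order_trans[OF norm_mult_ineq] mult_mono) auto
  moreover have "norm (star T * (e - T)) \<le> 2 * \<gamma>"
    using nT nT' \<gamma>0 by (intro order_trans[OF norm_mult_ineq] mult_mono) (auto simp: norm_star)
  ultimately have nw: "norm w \<le> 3 * \<gamma>"
    using norm_triangle_ineq[of "(e - star T) * e" "star T * (e - T)"] by simp
  then have "norm w \<le> 1/2" using \<gamma> by linarith
  from quasi_inverse[OF w(1) this]
  obtain n where n: "star n = n" "n = w + w * n" "norm n \<le> 2 * norm w" by metis
  have en: "e * n = n" by (metis distrib_left mult.assoc n(2) w(2))
  have ne': "n * e = n" using arg_cong[OF en, of star] by (simp add: star_mult e(1) n(1))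
  define e' where "e' = T * (e + n) * star T"
  have TT: "star T * T = e - w" by (simp add: w_def)
  have "(e - w) * (e + n) = e + n - (w + w * n)" by (simp add: algebra_simps e en we)
  then have TTm: "star T * T * (e + n) = e" by (simp add: TT flip: n(2))
  have "e' * e' = T * (e + n) * (star T * T * (e + n)) * star T"
    by (simp add: e'_def mult.assoc)
  also have "\<dots> = e'"
    by (simp only: TTm) (simp add: e'_def algebra_simps eT)
  finally have idem: "e' * e' = e'" .
  have sa: "star e' = e'" by (simp add: e'_def star_simps e n(1) mult.assoc)
  \<comment> \<open>The three terms contribute \<open>2 * \<gamma>\<close>, \<open>\<gamma>\<close>
    and \<open>24 * \<gamma>\<close>.\<close>
  have "e' - e = (T - e) * star T + e * (star T - e) + T * n * star T"
    by (simp add: e'_def algebra_simps e eT)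
  moreover have "norm ((T - e) * star T) \<le> \<gamma> * 2"
    using nT T(2) \<gamma>0 by (intro order_trans[OF norm_mult_ineq] mult_mono) (auto simp: norm_star)
  moreover have "norm (e * (star T - e)) \<le> 1 * \<gamma>"
    using nTs ne \<gamma>0
    by (intro order_trans[OF norm_mult_ineq] mult_mono) (auto simp: norm_minus_commute)
  moreover have "norm (T * n * star T) \<le> (2 * (6 * \<gamma>)) * 2"
    using nT n(3) nw \<gamma>0
    by (intro order_trans[OF norm_mult_ineq] mult_mono order_trans[OF norm_mult_ineq])
      (auto simp: norm_star)
  ultimately have "norm (e' - e) \<le> 27 * \<gamma>"
    using norm_triangle_ineq[of "(T - e) * star T + e * (star T - e)" "T * n * star T"]
      norm_triangle_ineq[of "(T - e) * star T" "e * (star T - e)"] by simp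
  then show thesis using that[of e' "(e + n) * star T"] idem sa by (simp add: e'_def mult.assoc)
qed

text \<open>The spectral projection of \<open>x = q p q\<close> for a small interval around \<open>1\<close> is approximated by a
  projection \<open>e0 = q - e1\<close> obtained from an invertible perturbation of \<open>(1 - \<delta>) q - x\<close>.  A
  projection \<open>r \<le> p, q\<close> satisfies \<open>r x = r\<close>, so that \<open>r (1 - x\<^sup>n) = 0\<close>, whereas \<open>(1 - x\<^sup>n) e1\<close> is
  close to \<open>e1\<close>; replacing \<open>e1\<close> by the range projection of \<open>(1 - x\<^sup>n) e1\<close> makes it orthogonal to
  every such \<open>r\<close>.\<close>
lemma approximate_meet:
  assumes rr0: "real_rank_zero smul star" and p: "star p = p" "p * p = p"
    and q: "star q = q" "q * q = q" and \<epsilon>0: "\<epsilon>0 > 0"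
  obtains e where "star e = e" "e * e = e" "e * q = e" "norm (e - e * p * e) \<le> \<epsilon>0"
    "\<And>r. r * q = r \<Longrightarrow> r * p = r \<Longrightarrow> r * e = r"
proof -
  define \<epsilon> where "\<epsilon> = min \<epsilon>0 1"
  have \<epsilon>: "0 < \<epsilon>" "\<epsilon> \<le> 1" "\<epsilon> \<le> \<epsilon>0" using \<epsilon>0 by (auto simp: \<epsilon>_def)
  \<comment> \<open>Half of \<epsilon> goes to \<open>e0\<close>, whose error is at most
    \<open>2 * \<delta> + 3 * \<eta> \<le> 5/2 * \<delta>\<close>, and half to the replacement of
    \<open>e1\<close> by \<open>e'\<close>, which costs \<open>2 * 27 * \<gamma>\<close>.\<close>
  define \<delta> where "\<delta> = \<epsilon> / 5"
  define \<gamma> where "\<gamma> = \<epsilon> / 108"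
  have \<delta>: "0 < \<delta>" "\<delta> \<le> 1/5" and \<gamma>: "0 < \<gamma>" "\<gamma> \<le> 1/6" using \<epsilon> by (auto simp: \<delta>_def \<gamma>_def)
  \<comment> \<open>On \<open>e1\<close> the compression \<open>x\<close> acts, up to an error
    \<open>\<eta>\<close>, with norm at most
    \<open>1 - \<delta> + 3 * \<eta> \<le> \<rho>\<close>.\<close>
  define \<rho> where "\<rho> = 1 - \<delta> / 2"
  have \<rho>: "0 < \<rho>" "\<rho> < 1" using \<delta> by (auto simp: \<rho>_def)
  obtain N where "\<rho> ^ N < \<gamma> / 2" using real_arch_pow_inv[of "\<gamma> / 2" \<rho>] \<gamma> \<rho> by auto
  then have N: "\<rho> ^ Suc N \<le> \<gamma> / 2"
    using \<rho> power_decreasing[of N "Suc N" \<rho>] by linarith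
  define \<eta> where "\<eta> = min (\<delta> / 6) (\<gamma> / 2 / Suc N)"
  have \<eta>: "0 < \<eta>" "\<eta> \<le> \<delta> / 6" "\<eta> \<le> \<gamma> / 2 / Suc N" 
    using \<delta> \<gamma> unfolding \<eta>_def by (simp, linarith, linarith)
  then have \<eta>N: "Suc N * \<eta> \<le> \<gamma> / 2" by (simp add: pos_le_divide_eq algebra_simps)
  note np = norm_proj_le[OF p] and nq = norm_proj_le[OF q]
  note qp_simps = q p mult_assoc_lift[OF q(2)] mult_assoc_lift[OF p(2)]
  define x where "x = q * p * q"
  have x: "star x = x" "q * x = x" "x * q = x"
    by (simp_all add: x_def star_mult qp_simps mult.assoc)
  have nx: "norm x \<le> 1"
  proof -
    have "norm (q * p * q) \<le> (1 * 1) * 1"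
      using np nq by (intro order_trans[OF norm_mult_ineq] mult_mono order_trans[OF norm_mult_ineq]) auto
    then show ?thesis by (simp add: x_def)
  qed
  \<comment> \<open>This encodes \<open>0 \<le> x \<le> q\<close>: \<open>?u\<close> is the symmetry
    \<open>2 p - 1\<close> times \<open>q\<close>, hence a partial isometry, and
    \<open>2 x - q\<close> is its compression.\<close>
  have n2x: "norm (2 *\<^sub>R x - q) \<le> 1"
  proof -
    let ?u = "2 *\<^sub>R (p * q) - q"
    have "star ?u * ?u = q"
      by (simp add: star_simps right_diff_distrib left_diff_distrib qp_simps mult.assoc)
        (simp add: scaleR_2)
    then have "(norm ?u)\<^sup>2 \<le> 1\<^sup>2" using nq cstar_identity[of ?u] by simp
    then have "norm ?u \<le> 1" by (rule power2_le_imp_le) simp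
    then have "norm (q * ?u) \<le> 1 * 1"
      using nq by (intro order_trans[OF norm_mult_ineq] mult_mono) auto
    moreover have "q * ?u = 2 *\<^sub>R x - q" by (simp add: x_def right_diff_distrib q mult.assoc)
    ultimately show ?thesis by simp
  qed
  have "star ((1 - \<delta>) *\<^sub>R q - x) = (1 - \<delta>) *\<^sub>R q - x" "q * ((1 - \<delta>) *\<^sub>R q - x) = (1 - \<delta>) *\<^sub>R q - x"
    by (simp_all add: star_simps q x right_diff_distrib)
  from invertible_dense_corner[OF rr0 q this \<eta>(1)]
  obtain y v where y: "star y = y" "q * y = y" and v: "q * v = v" "y * v = q"
    and yx: "norm ((1 - \<delta>) *\<^sub>R q - x - y) < \<eta>" by metis
  define k where "k = y - ((1 - \<delta>) *\<^sub>R q - x)"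
  have nk: "norm k \<le> \<eta>" using yx by (simp add: k_def norm_minus_commute)
  have xk: "x = (1 - \<delta>) *\<^sub>R q - y + k" by (simp add: k_def)
  obtain f R where fR: "star f = f" "star R = R" "q * f = f" "q * R = R" "f * f = q"
    "f * R = R * f" and yf: "y = f * (R * R)"
    using sign_decomposition[OF q y v] by metis
  have fq: "f * q = f" using arg_cong[OF fR(3), of star] by (simp add: star_mult q(1) fR(1))
  have Rq: "R * q = R" using arg_cong[OF fR(4), of star] by (simp add: star_mult q(1) fR(2))
  \<comment> \<open>The two spectral projections of the sign \<open>f\<close>. As \<open>y\<close>
    is close to \<open>(1 - \<delta>) q - x\<close>, roughly \<open>x \<le> 1 - \<delta>\<close> on
    \<open>e1\<close> and \<open>x \<ge> 1 - \<delta>\<close> on \<open>e0\<close>.\<close>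
  define e1 where "e1 = (1/2) *\<^sub>R (q + f)"
  define e0 where "e0 = (1/2) *\<^sub>R (q - f)"
  have e1: "star e1 = e1" "q * e1 = e1" "e1 * q = e1" "f * e1 = e1"
    and e0: "star e0 = e0" "q * e0 = e0" "f * e0 = - e0"
    and Re: "R * e1 = e1 * R" "R * e0 = e0 * R"
    by (simp_all add: e1_def e0_def star_simps q fR fq Rq distrib_left distrib_right
        right_diff_distrib left_diff_distrib flip: scaleR_minus_right)
  have "e1 * e1 = (1/2) *\<^sub>R (q * e1 + f * e1)" by (subst e1_def) (simp add: distrib_right)
  then have ee1: "e1 * e1 = e1" by (simp add: e1 flip: scaleR_2)
  have "e0 * e0 = (1/2) *\<^sub>R (q * e0 - f * e0)" by (subst e0_def) (simp add: left_diff_distrib)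
  then have ee0: "e0 * e0 = e0" by (simp add: e0 flip: scaleR_2)
  have e01: "e0 = q - e1" by (simp add: e0_def e1_def algebra_simps flip: scaleR_left_distrib)
  note ne1 = norm_proj_le[OF e1(1) ee1] and ne0 = norm_proj_le[OF e0(1) ee0]
  have nke: "norm (k * e1) \<le> \<eta>" "norm (k * e0) \<le> \<eta>"
    using order_trans[OF norm_mult_ineq mult_mono[OF nk ne1]]
      order_trans[OF norm_mult_ineq mult_mono[OF nk ne0]] \<eta> by auto

  \<comment> \<open>\<open>c0 * c0\<close> is the negative part of \<open>y\<close>, the excess of
    \<open>x\<close> over \<open>1 - \<delta>\<close> up to \<open>k\<close>. As
    \<open>norm x \<le> 1\<close>, \<open>norm_square_shift\<close> bounds it by about
    \<delta>.\<close>
  define c0 where "c0 = R * e0"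
  have c0: "star c0 = c0" "e0 * c0 = c0"
    by (simp_all add: c0_def star_mult fR e0 Re ee0 flip: mult.assoc)
  have "c0 * c0 = R * R * e0"
    by (simp add: c0_def mult.assoc mult_assoc_lift[OF Re(2)[symmetric]] ee0)
  moreover have "f * (R * R) = R * R * f"
    by (simp add: mult.assoc mult_assoc_lift[OF fR(6)] fR(6))
  ultimately have ye0: "y * e0 = - (c0 * c0)" by (simp add: yf e0 mult.assoc)
  have xe0: "x * e0 = (1 - \<delta>) *\<^sub>R e0 + c0 * c0 + k * e0"
    by (subst xk) (simp add: distrib_right left_diff_distrib e0 ye0)
  have "norm (x * e0) \<le> 1 * 1"
    using nx ne0 by (intro order_trans[OF norm_mult_ineq] mult_mono) auto
  moreover have "c0 * c0 - (\<delta> - 1) *\<^sub>R e0 = x * e0 - k * e0"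
    by (simp add: xe0 algebra_simps)
  ultimately have "norm (c0 * c0 - (\<delta> - 1) *\<^sub>R e0) < 1 + 2 * \<eta>"
    using norm_triangle_ineq4[of "x * e0" "k * e0"] nke \<eta>(1) by simp
  from norm_square_shift(1)[OF e0(1) ee0 c0 this]
  have nc0: "norm (c0 * c0) \<le> \<delta> + 2 * \<eta>" using \<delta> \<eta> by simp
  have "norm (e0 - x * e0) \<le> \<epsilon> / 2"
  proof -
    have eq: "e0 - x * e0 = \<delta> *\<^sub>R e0 - c0 * c0 - k * e0" by (simp add: xe0 algebra_simps)
    have "norm (\<delta> *\<^sub>R e0) \<le> \<delta>" using \<delta> ne0 by (simp add: mult_left_le)
    then have "norm (e0 - x * e0) \<le> \<delta> + (\<delta> + 2 * \<eta>) + \<eta>"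
      using nc0 nke norm_triangle_ineq4[of "\<delta> *\<^sub>R e0 - c0 * c0" "k * e0"]
        norm_triangle_ineq4[of "\<delta> *\<^sub>R e0" "c0 * c0"] unfolding eq by linarith
    then show ?thesis using \<eta> by (simp add: \<delta>_def)
  qed
  note nhe0 = this

  \<comment> \<open>On the other side \<open>c1 * c1\<close> is the positive part of
    \<open>y\<close>. Centring \<open>x\<close> at 1/2, where \<open>n2x\<close> applies, lets
    \<open>norm_square_shift\<close> bound \<open>a\<close> in norm by about
    \<open>1 - \<delta>\<close>.\<close>
  define c1 where "c1 = R * e1"
  have c1: "star c1 = c1" "e1 * c1 = c1"
    by (simp_all add: c1_def star_mult fR e1 Re ee1 flip: mult.assoc)
  have "c1 * c1 = R * R * e1"
    by (simp add: c1_def mult.assoc mult_assoc_lift[OF Re(1)[symmetric]] ee1)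
  moreover have "f * (R * R) = R * R * f"
    by (simp add: mult.assoc mult_assoc_lift[OF fR(6)] fR(6))
  ultimately have ye1: "y * e1 = c1 * c1" by (simp add: yf e1 mult.assoc)
  define a where "a = (1 - \<delta>) *\<^sub>R e1 - c1 * c1"
  have xe1: "x * e1 = a + k * e1"
    by (subst xk) (simp add: distrib_right left_diff_distrib e1 ye1 a_def)
  have ea: "e1 * a = a" by (simp add: a_def right_diff_distrib ee1 c1 flip: mult.assoc)
  have "norm ((2 *\<^sub>R x - q) * e1) \<le> 1 * 1"
    using n2x ne1 by (intro order_trans[OF norm_mult_ineq] mult_mono) auto
  moreover have "(2 *\<^sub>R x - q) * e1 = 2 *\<^sub>R (x * e1) - e1" by (simp add: left_diff_distrib e1)
  moreover have "c1 * c1 - (1/2 - \<delta>) *\<^sub>R e1 = k * e1 - (1/2) *\<^sub>R (2 *\<^sub>R (x * e1) - e1)"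
    by (simp add: xe1 a_def scaleR_diff_right scaleR_diff_left scaleR_add_right)
      (simp add: algebra_simps flip: scaleR_left_distrib)
  moreover have "norm ((1/2) *\<^sub>R (2 *\<^sub>R (x * e1) - e1)) = norm (2 *\<^sub>R (x * e1) - e1) / 2" by simp
  ultimately have "norm (c1 * c1 - (1/2 - \<delta>) *\<^sub>R e1) < 1/2 + 3/2 * \<eta>"
    using norm_triangle_ineq4[of "k * e1" "(1/2) *\<^sub>R (2 *\<^sub>R (x * e1) - e1)"] nke \<eta>(1) by simp
  note norm_square_shift(2)[OF e1(1) ee1 c1 this]
  moreover define \<tau> where "\<tau> = 1/2 + 3/2 * \<eta> + (1/2 - \<delta>)"
  ultimately have "norm (\<tau> *\<^sub>R e1 - c1 * c1) \<le> \<tau>" using \<delta> \<eta> by simp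
  moreover have coef: "1 - \<delta> = \<tau> - 3/2 * \<eta>" by (simp add: \<tau>_def)
  then have eqa: "a = (\<tau> *\<^sub>R e1 - c1 * c1) - (3/2 * \<eta>) *\<^sub>R e1"
    unfolding a_def coef by (simp add: scaleR_diff_left)
  moreover have "norm ((3/2 * \<eta>) *\<^sub>R e1) \<le> 3/2 * \<eta>" using \<eta> ne1 by (simp add: mult_left_le)
  ultimately have "norm a \<le> \<tau> + 3/2 * \<eta>"
    using norm_triangle_ineq4[of "\<tau> *\<^sub>R e1 - c1 * c1" "(3/2 * \<eta>) *\<^sub>R e1"]
    unfolding eqa[symmetric] by linarith
  then have na: "norm a \<le> \<rho>" using \<eta>(2) by (simp add: \<tau>_def \<rho>_def)

  define G where "G = pow1 x N"
  have nG: "norm (G * e1) \<le> \<gamma>"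
    using pow1_mult_le[OF nx xe1 ea na less_imp_le[OF \<rho>(2)] nke(1), of N] N \<eta>N
    unfolding G_def by linarith
  define T where "T = e1 - G * e1"
  have "T * e1 = T" by (simp add: T_def left_diff_distrib ee1 mult.assoc)
  moreover have "norm (T - e1) \<le> \<gamma>" using nG by (simp add: T_def)
  ultimately obtain e' n where e': "star e' = e'" "e' * e' = e'" "e' = T * n"
    and ne': "norm (e' - e1) \<le> 27 * \<gamma>"
    using range_projection[OF e1(1) ee1 _ _ \<gamma>(2)] by metis
  have "q * G = G" unfolding G_def by (cases N) (simp_all add: x flip: mult.assoc)
  then have "q * T = T" by (simp add: T_def right_diff_distrib e1 flip: mult.assoc)
  then have qe': "q * e' = e'" by (simp add: e'(3) flip: mult.assoc)
  have e'q: "e' * q = e'" using arg_cong[OF qe', of star] by (simp add: star_mult q(1) e'(1))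
  define e where "e = q - e'"
  have e: "star e = e" "e * e = e" "e * q = e" "q * e = e"
    by (simp_all add: e_def star_simps q e'(1,2) qe' e'q right_diff_distrib left_diff_distrib)
  have re: "r * e = r" if r: "r * q = r" "r * p = r" for r
  proof -
    have rx: "r * x = r" by (simp add: x_def mult_assoc_lift[OF r(1)] mult_assoc_lift[OF r(2)] r mult.assoc)
    have "r * pow1 x N = r" by (induction N) (simp_all add: rx flip: mult.assoc)
    then have "r * T = 0" by (simp add: T_def G_def right_diff_distrib flip: mult.assoc)
    then have "r * e' = 0" by (simp add: e'(3) flip: mult.assoc)
    then show ?thesis by (simp add: e_def right_diff_distrib r)
  qed
  \<comment> \<open>Now \<open>e\<close> is compared with \<open>e0\<close>, from which it differs
    by \<open>e1 - e'\<close>.\<close>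
  have "e - e * p * e = e * ((q - x) * e)"
    by (simp add: x_def left_diff_distrib right_diff_distrib e mult.assoc mult_assoc_lift[OF e(3)])
  also have "(q - x) * e = (e0 - x * e0) + (q - x) * (e1 - e')"
    by (simp add: e_def e01 algebra_simps q x e1 qe')
  finally have eh: "e - e * p * e = e * ((e0 - x * e0) + (q - x) * (e1 - e'))" .
  have "norm ((q - x) * (e1 - e')) \<le> 2 * (27 * \<gamma>)"
    using ne' norm_triangle_ineq4[of q x] nq nx
    by (intro order_trans[OF norm_mult_ineq] mult_mono) (auto simp: norm_minus_commute)
  then have "norm ((e0 - x * e0) + (q - x) * (e1 - e')) \<le> \<epsilon>"
    using norm_triangle_ineq[of "e0 - x * e0" "(q - x) * (e1 - e')"] nhe0 by (simp add: \<gamma>_def)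
  then have "norm (e - e * p * e) \<le> 1 * \<epsilon>"
    unfolding eh using norm_proj_le[OF e(1,2)]
    by (intro order_trans[OF norm_mult_ineq] mult_mono) auto
  then show thesis using that e re \<epsilon> by (metis mult_1 order_trans)
qed

subsection \<open>The order on projections\<close>

definition proj :: "'a \<Rightarrow> bool" where "proj p \<longleftrightarrow> star p = p \<and> p * p = p"

definition ple :: "'a \<Rightarrow> 'a \<Rightarrow> bool" where "ple p q \<longleftrightarrow> p * q = p"

lemma carrier_proj_order: "carrier (proj_order star) = {p. proj p}"
  by (simp add: proj_order_def proj_def)

lemma le_proj_order: "p \<sqsubseteq>\<^bsub>proj_order star\<^esub> q \<longleftrightarrow> ple p q"
  by (simp add: proj_order_def ple_def)

lemma lless_proj_order: "p \<sqsubset>\<^bsub>proj_order star\<^esub> q \<longleftrightarrow> ple p q \<and> p \<noteq> q"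
  by (simp add: lless_def proj_order_def ple_def)

lemma ple_refl: "proj p \<Longrightarrow> ple p p"
  by (simp add: proj_def ple_def)

lemma ple_trans: "ple p q \<Longrightarrow> ple q r \<Longrightarrow> ple p r"
  unfolding ple_def by (metis mult.assoc)

lemma ple_flip: "proj p \<Longrightarrow> proj q \<Longrightarrow> ple p q \<Longrightarrow> q * p = p"
  unfolding ple_def proj_def by (metis star_mult)

lemma ple_antisym: "proj p \<Longrightarrow> proj q \<Longrightarrow> ple p q \<Longrightarrow> ple q p \<Longrightarrow> p = q"
  using ple_flip[of p q] by (simp add: ple_def)

lemma proj_diff:
  assumes "proj p" "proj q" "ple p q" shows "proj (q - p)"
  using assms ple_flip[OF assms]
  by (simp add: proj_def ple_def star_diff right_diff_distrib left_diff_distrib)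

lemma ple_diff: "proj q \<Longrightarrow> ple p q \<Longrightarrow> ple (q - p) q"
  by (simp add: proj_def ple_def left_diff_distrib)

text \<open>Complementation inside \<open>q\<close> replaces \<open>1 - p\<close>, and carries
  statements on lower bounds over to upper bounds.\<close>

lemma ple_diff_antimono:
  assumes "proj p" "proj q" "proj t" "ple p q" "ple t q"
  shows "ple (q - t) (q - p) \<longleftrightarrow> ple p t"
proof -
  have "(q - t) * (q - p) = q - t - p + t * p"
    using assms ple_flip[of p q] by (simp add: proj_def ple_def algebra_simps)
  moreover have "ple p t \<longleftrightarrow> t * p = p"
    using assms unfolding ple_def proj_def by (metis star_mult)
  ultimately show ?thesis unfolding ple_def[of "q - t"] by auto
qed

section \<open>Decreasing sequences and interpolation\<close>

lemma decreasing_ple: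
  assumes "\<And>n. proj (w n)" "\<And>n. ple (w (Suc n)) (w n)" "m \<le> n"
  shows "ple (w n) (w m)"
  using assms(3) by (induction rule: dec_induct) (use assms ple_refl ple_trans in blast)+

text \<open>\<open>w (Suc n)\<close> is an approximate meet of \<open>w n\<close> and
  \<open>g n\<close>. Lower bounds of \<open>Q\<close> survive each step exactly, while a lower
  bound of the sequence sees each \<open>p\<close> in \<open>Q\<close> with arbitrarily small
  error.\<close>

lemma decreasing_sequence_same_lower_bounds:
  assumes rr0: "real_rank_zero smul star" and Q: "countable Q" "\<And>q. q \<in> Q \<Longrightarrow> proj q"
    and q0: "q0 \<in> Q"
  obtains w :: "nat \<Rightarrow> 'a" where "\<forall>n. proj (w n)" "\<forall>n. ple (w (Suc n)) (w n)" "w 0 = q0"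
    "\<forall>r. proj r \<longrightarrow> (\<forall>n. ple r (w n)) = (\<forall>q\<in>Q. ple r q)"
proof -
  \<comment> \<open>Dropping the second component of the pair code makes every member of
    \<open>Q\<close> recur infinitely often, even if \<open>Q\<close> is finite.\<close>
  define g where "g n = from_nat_into Q (fst (prod_decode n))" for n
  have gQ: "g n \<in> Q" for n unfolding g_def using from_nat_into[of Q] q0 by blast
  have "\<exists>w. \<forall>n. ((star (w n) = w n \<and> w n * w n = w n) \<and> (n = 0 \<longrightarrow> w n = q0)) \<and>
     (w (Suc n) * w n = w (Suc n)
       \<and> norm (w (Suc n) - w (Suc n) * g n * w (Suc n)) \<le> 1 / Suc n
       \<and> (\<forall>r. r * w n = r \<longrightarrow> r * g n = r \<longrightarrow> r * w (Suc n) = r))" (is "\<exists>w. \<forall>n. ?S w n")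
  proof (rule dependent_nat_choice[where
        P = "\<lambda>n x. (star x = x \<and> x * x = x) \<and> (n = 0 \<longrightarrow> x = q0)" and
        Q = "\<lambda>n x y. y * x = y \<and> norm (y - y * g n * y) \<le> 1 / Suc n
          \<and> (\<forall>r. r * x = r \<longrightarrow> r * g n = r \<longrightarrow> r * y = r)"], goal_cases)
    case 1
    then show ?case using Q(2)[OF q0] unfolding proj_def by blast
  next
    case (2 x n)
    have "star (g n) = g n" "g n * g n = g n" "star x = x" "x * x = x" "1 / real (Suc n) > 0"
      using Q(2)[OF gQ] 2 by (auto simp: proj_def)
    from approximate_meet[OF rr0 this] show ?case by (metis nat.distinct(1))
  qed
  then obtain w where W: "\<And>n. ?S w n" by blast
  have w: "\<And>n. star (w n) = w n \<and> w n * w n = w n" "w 0 = q0"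
    "\<And>n. w (Suc n) * w n = w (Suc n)"
    "\<And>n. norm (w (Suc n) - w (Suc n) * g n * w (Suc n)) \<le> 1 / Suc n"
    "\<And>n r. r * w n = r \<Longrightarrow> r * g n = r \<Longrightarrow> r * w (Suc n) = r"
    using W by simp_all
  have "(\<forall>n. r * w n = r) \<longleftrightarrow> (\<forall>q\<in>Q. r * q = r)" if r: "star r = r" for r
  proof
    assume Qr: "\<forall>q\<in>Q. r * q = r"
    have "r * w n = r" for n
      by (induction n) (use Qr q0 gQ w in auto)
    then show "\<forall>n. r * w n = r" by blast
  next
    assume rw: "\<forall>n. r * w n = r"
    show "\<forall>q\<in>Q. r * q = r"
    proof
      fix p assume p: "p \<in> Q"
      then have pp: "star p = p" "p * p = p" using Q by (auto simp: proj_def)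
      have wr: "w n * r = r" for n
        using arg_cong[OF rw[rule_format], of star] by (simp add: star_mult r w)
      have le: "norm (r * r - r * p * r) \<le> inverse (Suc m) * (norm r * norm r)" for m
      proof -
        define n where "n = prod_encode (to_nat_on Q p, m)"
        have gn: "g n = p" using p Q(1) by (simp add: g_def n_def)
        have "m \<le> n" by (simp add: n_def le_prod_encode_2)
        then have "1 / Suc n \<le> inverse (real (Suc m))" by (simp add: field_simps)
        then have nm: "norm (w (Suc n) - w (Suc n) * p * w (Suc n)) \<le> inverse (Suc m)"
          using w(4)[of n] gn by simp
        have "r * r - r * p * r = r * (w (Suc n) - w (Suc n) * p * w (Suc n)) * r"
          using rw wr by (simp add: right_diff_distrib left_diff_distrib flip: mult.assoc)
            (simp add: mult.assoc)
        then have "norm (r * r - r * p * r) \<le> (norm r * inverse (Suc m)) * norm r"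
          using nm by (simp only:)
            (intro order_trans[OF norm_mult_ineq] mult_mono order_trans[OF norm_mult_ineq] mult_left_mono, auto)
        then show ?thesis by (simp add: mult_ac)
      qed
      have "(\<lambda>m. inverse (real (Suc m)) * (norm r * norm r)) \<longlonglongrightarrow> 0 * (norm r * norm r)"
        by (intro tendsto_mult LIMSEQ_inverse_real_of_nat tendsto_const)
      then have "norm (r * r - r * p * r) \<le> 0 * (norm r * norm r)"
        by (rule LIMSEQ_le_const) (use le in blast)
      then have z: "r * r - r * p * r = 0" by simp
      \<comment> \<open>In unital terms \<open>r (1 - p) r = 0\<close> says that
        \<open>r (1 - p)\<close> times its adjoint vanishes.\<close>
      have "(r - r * p) * star (r - r * p) = r * r - r * p * r"
        by (simp add: star_simps r pp right_diff_distrib left_diff_distrib mult.assoc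
            mult_assoc_lift[OF pp(2)])
      then have "r - r * p = 0" using mult_star_self_eq_0 z by metis
      then show "r * p = r" by simp
    qed
  qed
  then show thesis using that[of w] w by (simp add: proj_def ple_def)
qed

lemma interpolating_projection:
  assumes rr0: "real_rank_zero smul star"
    and nogap: "\<not> (\<exists>P' Q'. omega_omega_gap (proj_order star) P' Q')"
    and P: "countable P" "P \<noteq> {}" "\<And>p. p \<in> P \<Longrightarrow> proj p"
    and Q: "countable Q" "Q \<noteq> {}" "\<And>q. q \<in> Q \<Longrightarrow> proj q"
    and PQ: "\<And>p q. p \<in> P \<Longrightarrow> q \<in> Q \<Longrightarrow> ple p q"
  obtains r where "proj r" "\<forall>p\<in>P. ple p r" "\<forall>q\<in>Q. ple r q"
proof -
  obtain q0 p0 where q0: "q0 \<in> Q" and p0: "p0 \<in> P" using P Q by blast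
  note pq0 = Q(3)[OF q0]
  obtain w where "\<forall>n. proj (w n)" "\<forall>n. ple (w (Suc n)) (w n)" "w 0 = q0"
    "\<forall>r. proj r \<longrightarrow> (\<forall>n. ple r (w n)) = (\<forall>q\<in>Q. ple r q)"
    using decreasing_sequence_same_lower_bounds[OF rr0 Q(1) Q(3) q0] .
  note w = this[rule_format]
  let ?P' = "(\<lambda>p. q0 - p) ` P"
  have P': "countable ?P'" "q0 - p0 \<in> ?P'" "\<And>p. p \<in> ?P' \<Longrightarrow> proj p"
    using P p0 proj_diff[OF P(3) pq0 PQ[OF _ q0]] by auto
  obtain v where "\<forall>n. proj (v n)" "\<forall>n. ple (v (Suc n)) (v n)" "v 0 = q0 - p0"
    "\<forall>r. proj r \<longrightarrow> (\<forall>n. ple r (v n)) = (\<forall>q\<in>?P'. ple r q)"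
    using decreasing_sequence_same_lower_bounds[OF rr0 P'(1,3,2)] .
  note v = this[rule_format]
  have wq0: "ple (w n) q0" for n using decreasing_ple[of w 0 n] w by simp
  have vq0: "ple (v n) q0" for n
    using decreasing_ple[of v 0 n] v ple_diff[OF pq0 PQ[OF p0 q0]] ple_trans by fastforce
  define u where "u n = q0 - v n" for n
  have u: "proj (u n)" "ple (u n) q0" for n
    using proj_diff[OF v(1) pq0 vq0] ple_diff[OF pq0 vq0] by (simp_all add: u_def)
  have u_inc: "ple (u m) (u n)" if "m \<le> n" for m n
    using decreasing_ple[of v m n] ple_diff_antimono[of "v n" q0 "v m"] v pq0 vq0 that
    by (simp add: u_def)
  have w_dec: "ple (w n) (w m)" if "m \<le> n" for m n
    using decreasing_ple[of w m n] w that by simp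
  \<comment> \<open>Complements in \<open>q0\<close> see only upper bounds below \<open>q0\<close>.
    This loses nothing: whatever lies below all \<open>w n\<close> lies below
    \<open>w 0 = q0\<close>.\<close>
  have ub: "(\<forall>n. ple (u n) t) \<longleftrightarrow> (\<forall>p\<in>P. ple p t)" if t: "proj t" "ple t q0" for t
  proof -
    have "ple (u n) t \<longleftrightarrow> ple (q0 - t) (v n)" for n
      using ple_diff_antimono[OF u(1) pq0 t(1) u(2) t(2)] by (simp add: u_def)
    moreover have "ple p t \<longleftrightarrow> ple (q0 - t) (q0 - p)" if "p \<in> P" for p
      using ple_diff_antimono[OF P(3)[OF that] pq0 t(1) PQ[OF that q0] t(2)] by simp
    ultimately show ?thesis using v(4)[OF proj_diff[OF t(1) pq0 t(2)]] by simp
  qed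
  have Pw: "ple p (w n)" if "p \<in> P" for p n
    using w(4)[OF P(3)[OF that]] PQ[OF that] by blast
  have uw: "ple (u m) (w n)" for m n using ub[OF w(1) wq0] Pw by blast
  show thesis
  proof (cases "(\<exists>N. \<forall>n>N. w n = w N) \<or> (\<exists>N. \<forall>n>N. u n = u N)")
    case True
    then obtain r where r: "proj r" "\<And>m. ple (u m) r" "\<And>n. ple r (w n)"
    proof
      assume "\<exists>N. \<forall>n>N. w n = w N"
      then obtain N where "\<forall>n>N. w n = w N" ..
      then have "ple (w N) (w n)" for n
        using w_dec[of n N] ple_refl[OF w(1)] by (metis not_le)
      then show thesis by (rule that[OF w(1) uw])
    next
      assume "\<exists>N. \<forall>n>N. u n = u N"
      then obtain N where "\<forall>n>N. u n = u N" ..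
      then have "ple (u n) (u N)" for n
        using u_inc[of n N] ple_refl[OF u(1)] by (metis not_le)
      then show thesis by (rule that[OF u(1) _ uw])
    qed
    then have "ple r q0" using ple_trans wq0 by blast
    then show thesis using that r ub[OF r(1)] w(4)[OF r(1)] by blast
  next
    case False
    then obtain \<phi> \<psi> where \<phi>: "strict_mono \<phi>" "\<And>n. w (\<phi> (Suc n)) \<noteq> w (\<phi> n)"
      and \<psi>: "strict_mono \<psi>" "\<And>n. u (\<psi> (Suc n)) \<noteq> u (\<psi> n)"
      using strictly_changing_subsequence[of w] strictly_changing_subsequence[of u] by metis
    \<comment> \<open>A pregap demands strict inequalities: an upper bound equal to
      \<open>u (\<psi> m)\<close> would force \<open>u (\<psi> (Suc m))\<close> to equal it
      too.\<close>
    have u_ne: "u (\<psi> m) \<noteq> t" if "proj t" "\<And>n. ple (u n) t" for m t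
      using \<psi>(2)[of m] ple_antisym[OF u(1) u(1)] u_inc[of "\<psi> m" "\<psi> (Suc m)"]
        strict_monoD[OF \<psi>(1), of m "Suc m"] that by (metis lessI less_imp_le)
    have w_ne: "t \<noteq> w (\<phi> m)" if "proj t" "\<And>n. ple t (w n)" for m t
      using \<phi>(2)[of m] ple_antisym[OF w(1) w(1)] w_dec[of "\<phi> m" "\<phi> (Suc m)"]
        strict_monoD[OF \<phi>(1), of m "Suc m"] that by (metis lessI less_imp_le)
    have u_strict: "ple (u (\<psi> m)) (u (\<psi> n)) \<and> u (\<psi> m) \<noteq> u (\<psi> n)" if "m < n" for m n
    proof -
      have "\<psi> (Suc m) \<le> \<psi> n" "\<psi> m < \<psi> (Suc m)"
        using \<psi>(1) that by (simp_all add: strict_mono_less_eq strict_mono_less)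
      then have "ple (u (\<psi> m)) (u (\<psi> (Suc m)))" "ple (u (\<psi> (Suc m))) (u (\<psi> n))"
        using u_inc by simp_all
      then show ?thesis using \<psi>(2)[of m] ple_antisym[OF u(1) u(1)] ple_trans by metis
    qed
    have w_strict: "ple (w (\<phi> n)) (w (\<phi> m)) \<and> w (\<phi> n) \<noteq> w (\<phi> m)" if "m < n" for m n
    proof -
      have "\<phi> (Suc m) \<le> \<phi> n" "\<phi> m < \<phi> (Suc m)"
        using \<phi>(1) that by (simp_all add: strict_mono_less_eq strict_mono_less)
      then have "ple (w (\<phi> (Suc m))) (w (\<phi> m))" "ple (w (\<phi> n)) (w (\<phi> (Suc m)))"
        using w_dec by simp_all
      then show ?thesis using \<phi>(2)[of m] ple_antisym[OF w(1) w(1)] ple_trans by metis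
    qed
    let ?U = "range (\<lambda>n. u (\<psi> n))" and ?W = "range (\<lambda>n. w (\<phi> n))"
    have "pregap (proj_order star) ?U ?W"
      using u w u_ne uw
      by (auto simp: pregap_def carrier_proj_order lless_proj_order)
    moreover have "\<not> gap (proj_order star) ?U ?W"
    proof
      assume "gap (proj_order star) ?U ?W"
      then have "omega_omega_gap (proj_order star) ?U ?W"
        unfolding omega_omega_gap_def lless_proj_order using u_strict w_strict by blast
      then show False using nogap by blast
    qed
    ultimately obtain r where r: "proj r" "\<And>n. ple (u (\<psi> n)) r" "\<And>n. ple r (w (\<phi> n))"
      by (auto simp: gap_def interpolates_def carrier_proj_order lless_proj_order)
    \<comment> \<open>Subsequences are cofinal: \<open>n \<le> \<phi> n\<close>, and likewise for
      \<psi>.\<close>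
    have "ple r (w n)" for n
      using r(3) w_dec[OF strict_mono_imp_increasing[OF \<phi>(1)]] ple_trans by blast
    moreover have "ple (u n) r" for n
      using r(2) u_inc[OF strict_mono_imp_increasing[OF \<psi>(1)]] ple_trans by blast
    moreover have "ple r q0" using calculation(1)[of 0] w(3) by simp
    ultimately show thesis using that r ub[OF r(1)] w(4)[OF r(1)] by blast
  qed
qed

text \<open>The nonzero projection \<open>q - p\<close> is not an atom, so some nonzero
  \<open>b\<close> lies strictly below it; take \<open>p + b\<close>.\<close>

lemma atomless_dense:
  assumes "\<not> (\<exists>a. atom (proj_order star) a)" and p: "proj p" and q: "proj q"
    and pq: "ple p q" "p \<noteq> q"
  obtains r where "proj r" "ple p r" "ple r q" "r \<noteq> p" "r \<noteq> q"
proof -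
  have qp: "proj (q - p)" using proj_diff p q pq by blast
  have "\<not> atom (proj_order star) (q - p)" using assms(1) by blast
  then obtain b where b: "proj b" "b \<noteq> 0" "ple b (q - p)" "b \<noteq> q - p"
    using qp pq(2) by (auto simp: atom_def carrier_proj_order lless_proj_order bottom_proj_order)
  have qp': "(q - p) * p = 0" "p * (q - p) = 0" "(q - p) * q = q - p"
    using p q pq ple_flip[of p q] by (auto simp: proj_def ple_def left_diff_distrib right_diff_distrib)
  have bqp: "b * (q - p) = b" "(q - p) * b = b" using b ple_flip[OF b(1) qp b(3)] by (auto simp: ple_def)
  have bp: "b * p = 0" "p * b = 0" "b * q = b"
    using mult_assoc_lift[OF bqp(1), of p] mult_assoc_lift[OF qp'(2), of b]
      mult_assoc_lift[OF bqp(1), of q] qp' bqp by simp_all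
  show thesis
  proof (rule that[of "p + b"])
    show "proj (p + b)" "ple p (p + b)" "ple (p + b) q"
      using b p pq bp by (simp_all add: proj_def ple_def star_add distrib_left distrib_right)
    show "p + b \<noteq> p" "p + b \<noteq> q" using b by auto
  qed
qed

end

theorem theorem5p7:
  fixes smul :: "'f::scalar_field \<Rightarrow> 'a::{real_normed_algebra, banach} \<Rightarrow> 'a"
    and star :: "'a \<Rightarrow> 'a"
    and P Q :: "'a set"
  assumes "cstar_algebra smul star"
    and "real_rank_zero smul star"
    and "\<not> (\<exists>a. atom (proj_order star) a)"
    and "\<not> (\<exists>P' Q'. omega_omega_gap (proj_order star) P' Q')"
    and "countable P" and "P \<noteq> {}"
    and "countable Q" and "Q \<noteq> {}"
    and "gap (proj_order star) P Q"
  shows "\<exists>s\<in>P \<union> Q. least (proj_order star) s (Upper (proj_order star) P)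
                  \<and> greatest (proj_order star) s (Lower (proj_order star) Q)"
proof -
  interpret cstar_algebra smul star by (rule assms(1))
  note rr0 = assms(2) and atomless = assms(3) and nogap = assms(4) and P = assms(5,6)
    and Q = assms(7,8) and gap = assms(9)
  have PQ: "\<And>p. p \<in> P \<Longrightarrow> proj p" "\<And>q. q \<in> Q \<Longrightarrow> proj q" "\<And>p q. p \<in> P \<Longrightarrow> q \<in> Q \<Longrightarrow> ple p q"
    using gap by (auto simp: gap_def pregap_def carrier_proj_order lless_proj_order)
  define M where "M = {r. proj r \<and> (\<forall>p\<in>P. ple p r) \<and> (\<forall>q\<in>Q. ple r q)}"
  \<comment> \<open>A member of \<open>M\<close> outside both sets would satisfy all inequalities
    strictly and interpolate.\<close>
  have M_sub: "M \<subseteq> P \<union> Q"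
    using gap by (auto simp: M_def gap_def interpolates_def carrier_proj_order lless_proj_order)
  obtain s where "proj s" "\<forall>p\<in>P. ple p s" "\<forall>q\<in>Q. ple s q"
    using interpolating_projection[OF rr0 nogap P PQ(1) Q PQ(2,3)] .
  then have s: "s \<in> M" by (simp add: M_def)
  \<comment> \<open>A \<open>z\<close> strictly between would lie in \<open>P\<close>, hence below
    \<open>r\<close>, or in \<open>Q\<close>, hence above \<open>t\<close>.\<close>
  have no_lt: "r = t" if r: "r \<in> M" "t \<in> M" "ple r t" for r t
  proof (rule ccontr)
    assume "r \<noteq> t"
    then obtain z where z: "proj z" "ple r z" "ple z t" "z \<noteq> r" "z \<noteq> t"
      using atomless_dense[OF atomless, of r t] r by (auto simp: M_def)
    have "ple p z" if "p \<in> P" for p using ple_trans[OF _ z(2)] r that by (simp add: M_def)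
    moreover have "ple z q" if "q \<in> Q" for q using ple_trans[OF z(3)] r that by (simp add: M_def)
    ultimately have "z \<in> M" using z(1) by (simp add: M_def)
    then have "z \<in> P \<or> z \<in> Q" using M_sub by blast
    then have "ple z r \<or> ple t z" using r by (auto simp: M_def)
    then show False using z r ple_antisym[of r z] ple_antisym[of z t] by (auto simp: M_def)
  qed
  \<comment> \<open>Members of \<open>M\<close> lie in \<open>P\<close> or \<open>Q\<close>, so any
    two are comparable.\<close>
  have unique: "t = s" if t: "t \<in> M" for t
  proof -
    have "t \<in> P \<or> t \<in> Q" using t M_sub by blast
    then have "ple t s \<or> ple s t" using s by (auto simp: M_def)
    then show ?thesis using no_lt s t by metis
  qed
  have sp: "proj s" "\<And>p. p \<in> P \<Longrightarrow> ple p s" "\<And>q. q \<in> Q \<Longrightarrow> ple s q" using s by (auto simp: M_def)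
  have sPQ: "s \<in> P \<or> s \<in> Q" using s M_sub by blast
  have least: "ple s u" if u: "proj u" "\<And>p. p \<in> P \<Longrightarrow> ple p u" for u
  proof -
    have "\<And>q. q \<in> {s, u} \<Longrightarrow> proj q" "\<And>p q. p \<in> P \<Longrightarrow> q \<in> {s, u} \<Longrightarrow> ple p q"
      "countable {s, u}" "{s, u} \<noteq> {}"
      using sp u by auto
    note * = interpolating_projection[OF rr0 nogap P PQ(1) this(3,4,1,2)]
    obtain t where "proj t" "\<forall>p\<in>P. ple p t" "\<forall>q\<in>{s, u}. ple t q"
      using * .
    then have t: "proj t" "\<And>p. p \<in> P \<Longrightarrow> ple p t" "ple t s" "ple t u" by simp_all
    \<comment> \<open>Being below \<open>s\<close>, \<open>t\<close> is below all of
      \<open>Q\<close>; uniqueness then gives \<open>t = s\<close>.\<close>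
    then have "t \<in> M" using sp(3) ple_trans[OF t(3)] by (simp add: M_def)
    then show ?thesis using unique t by metis
  qed
  have greatest: "ple l s" if l: "proj l" "\<And>q. q \<in> Q \<Longrightarrow> ple l q" for l
  proof -
    have "\<And>q. q \<in> {s, l} \<Longrightarrow> proj q" "\<And>p q. p \<in> {s, l} \<Longrightarrow> q \<in> Q \<Longrightarrow> ple p q"
      "countable {s, l}" "{s, l} \<noteq> {}"
      using sp l by auto
    note * = interpolating_projection[OF rr0 nogap this(3,4,1) Q PQ(2) this(2)]
    obtain t where "proj t" "\<forall>p\<in>{s, l}. ple p t" "\<forall>q\<in>Q. ple t q"
      using * .
    then have t: "proj t" "\<And>q. q \<in> Q \<Longrightarrow> ple t q" "ple s t" "ple l t" by simp_all
    then have "t \<in> M" using sp(2) ple_trans[OF _ t(3)] by (simp add: M_def)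
    then show ?thesis using unique t by metis
  qed
  have "Order.least (proj_order star) s (Upper (proj_order star) P)"
    using sp least PQ by (auto simp: least_def Upper_def carrier_proj_order le_proj_order)
  moreover have "Order.greatest (proj_order star) s (Lower (proj_order star) Q)"
    using sp greatest PQ by (auto simp: greatest_def Lower_def carrier_proj_order le_proj_order)
  ultimately show ?thesis using sPQ by blast
qed

end
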